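(* Let $n\geq 5$ be an integer with $n\neq 6$. (1) If $\varphi(n)$ is not a power of $2$, then for every odd prime divisor $p$ of $\varphi(n)$, there exists an undirected $p$-integral Cayley graph over $\mathbb{Z}_n$ with valency $\frac{\varphi(n)}{p}$. (2) If $\varphi(n)$ is a power of $2$, then there exists an undirected $2$-integral Cayley graph over $\mathbb{Z}_n$ with valency $\frac{\varphi(n)}{2}$. In particular, for every prime $p$ and every integer $k\geq 3$, there exists a connected $p$-integral undirected circulant graph of order $p^k$ and valency $p^{k-2}(p-1)$.
   Context: For a finite group $G$ and a subset $S\subseteq G$ with $1_G\notin S$, $\mathrm{Cay}(G,S)$ is the (di)graph with vertex set $G$ in which $(g,h)$ is an arc if and only if $hg^{-1}\in S$; it is undirected if $S=S^{-1}$. Graphs are loop-free and non-empty. A circulant graph is a Cayley graph over a cyclic group. For a graph $\Gamma$, $\mathbb{SF}(\Gamma)$ is the smallest extension of $\mathbb{Q}$ containing all eigenvalues of the adjacency matrix of $\Gamma$, and $\Gamma$ is $k$-integral if $[\mathbb{SF}(\Gamma):\mathbb{Q}]=k$. $\varphi$ is Euler's function. *)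

theory Defs
  imports
    "HOL-Algebra.Elementary_Groups"
    "HOL-Algebra.Coset"
    "HOL-Algebra.Generated_Fields"
    "HOL-Algebra.Embedded_Algebras"
    "HOL-Algebra.Algebraic_Closure_Type"
    "HOL-Number_Theory.Totient"
    "Graph_Theory.Graph_Theory"
    "Jordan_Normal_Form.Char_Poly"
begin

text \<open>
  \<open>(g, h)\<close> is an arc iff \<open>h g\<^sup>-\<^sup>1 \<in> S\<close>. The side conditions on \<open>S\<close> are in
  \<open>undirected_cayley\<close> below.
\<close>

definition Cay :: "('a, 'b) monoid_scheme \<Rightarrow> 'a set \<Rightarrow> 'a pair_pre_digraph" where
  "Cay G S = \<lparr> pverts = carrier G,
               parcs = {(g, h). g \<in> carrier G \<and> h \<in> carrier G \<and> h \<otimes>\<^bsub>G\<^esub> inv\<^bsub>G\<^esub> g \<in> S} \<rparr>"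

text \<open>
  \<open>S \<noteq> {}\<close> expresses the convention that graphs are non-empty; \<open>\<one> \<notin> S\<close> makes them loop-free.
\<close>

definition undirected_cayley :: "('a, 'b) monoid_scheme \<Rightarrow> 'a pair_pre_digraph \<Rightarrow> bool" where
  "undirected_cayley G \<Gamma> \<longleftrightarrow>
     group G \<and> finite (carrier G) \<and>
     (\<exists>S. S \<subseteq> carrier G \<and> S \<noteq> {} \<and> \<one>\<^bsub>G\<^esub> \<notin> S \<and> set_inv\<^bsub>G\<^esub> S = S \<and> \<Gamma> = Cay G S)"

definition undirected_circulant :: "'a pair_pre_digraph \<Rightarrow> bool" where
  "undirected_circulant \<Gamma> \<longleftrightarrow>
     (\<exists>G :: 'a monoid. cyclic_group G \<and> undirected_cayley G \<Gamma>)"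

text \<open>Only used for undirected graphs, where the out-degree of a vertex is its degree.\<close>

definition has_valency :: "'a pair_pre_digraph \<Rightarrow> nat \<Rightarrow> bool" where
  "has_valency \<Gamma> d \<longleftrightarrow> (\<forall>v \<in> pverts \<Gamma>. out_degree (with_proj \<Gamma>) v = d)"

text \<open>The adjacency matrix, with rows and columns indexed along the list \<open>vs\<close> of vertices.\<close>

definition adjacency_matrix :: "'a pair_pre_digraph \<Rightarrow> 'a list \<Rightarrow> complex mat" where
  "adjacency_matrix \<Gamma> vs =
     mat (length vs) (length vs) (\<lambda>(i, j). if (vs ! i, vs ! j) \<in> parcs \<Gamma> then 1 else 0)"

text \<open>
  Two enumerations of the vertices give permutation-similar matrices, so the quantifier over
  enumerations does not affect the set of eigenvalues.
\<close>

definition graph_eigenvalues :: "'a pair_pre_digraph \<Rightarrow> complex set" where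
  "graph_eigenvalues \<Gamma> =
     {x. \<exists>vs. distinct vs \<and> set vs = pverts \<Gamma> \<and> eigenvalue (adjacency_matrix \<Gamma> vs) x}"

abbreviation complex_ring :: "complex ring" where
  "complex_ring \<equiv> ring_of_type_algebra"

text \<open>
  Every subfield of the complex numbers contains the rationals, so the generated subfield is the
  smallest extension of \<open>\<rat>\<close> containing the eigenvalues.
\<close>

definition splitting_field :: "'a pair_pre_digraph \<Rightarrow> complex set" where
  "splitting_field \<Gamma> = generate_field complex_ring (graph_eigenvalues \<Gamma>)"

definition k_integral :: "nat \<Rightarrow> 'a pair_pre_digraph \<Rightarrow> bool" where
  "k_integral k \<Gamma> \<longleftrightarrow> ring.dimension complex_ring k \<rat> (splitting_field \<Gamma>)"

end

theory Submission
  imports Defs "HOL-Computational_Algebra.Polynomial_Factorial" "HOL-Number_Theory.Residues"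
    "HOL-Algebra.Sylow"
begin

text \<open>
  Take a subgroup \<open>H\<close> of prime index \<open>p\<close> in the unit group of \<open>\<int>/n\<close> that contains \<open>-1\<close>, and
  the Cayley graph with connection set \<open>H\<close>. For a primitive \<open>n\<close>-th root of unity \<open>\<zeta>\<close>, the
  eigenvalues of \<open>Cay(\<int>/n, S)\<close> are the sums \<open>\<lambda>\<^sub>j\<close> of \<open>\<zeta>\<close> to the powers \<open>s j\<close>, \<open>s \<in> S\<close>, and the Galois
  automorphism \<open>\<zeta> \<mapsto> \<zeta>\<^sup>t\<close> maps the family of the \<open>\<lambda>\<^sub>j\<close> to the one of the connection set \<open>t S\<close>. By Fourier
  inversion the family determines \<open>S\<close>, so the degree of the splitting field is the number of distinct sets
  \<open>t S\<close>, which for \<open>S = H\<close> is the index of \<open>H\<close>.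

  Instead of Galois theory we use that a polynomial relation over \<open>\<int>\<close> for \<open>\<zeta>\<close> holds for every
  \<open>\<zeta>\<^sup>t\<close> with \<open>t\<close> prime to \<open>n\<close>. An integer combination \<open>\<alpha>\<close> of the \<open>\<lambda>\<^sub>j\<close> with generic
  coefficients is a primitive element, as Lagrange interpolation through its conjugates shows.
\<close>

section \<open>Integer polynomials at roots of unity\<close>

text \<open>The point comes first, so that \<open>int_eval z\<close> is the evaluation homomorphism
  on Z[x], with image Z[z].\<close>

definition int_eval :: "complex \<Rightarrow> int poly \<Rightarrow> complex" where
  "int_eval z g = poly (of_int_poly g) z"

interpretation int_eval: comm_ring_hom "int_eval z"
  by unfold_locales (auto simp: int_eval_def of_int_poly_hom.hom_add of_int_poly_hom.hom_mult)

lemma int_eval_pCons [simp]: "int_eval z (pCons a g) = of_int a + z * int_eval z g"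
  by (simp add: int_eval_def of_int_hom.map_poly_pCons_hom)

lemma int_eval_0 [simp]: "int_eval z 0 = 0"
  by (simp add: int_eval_def)

lemma int_eval_monom [simp]: "int_eval z (monom a k) = of_int a * z ^ k"
  by (simp add: int_eval_def map_poly_monom poly_monom)

lemma int_eval_smult [simp]: "int_eval z (smult a g) = of_int a * int_eval z g"
  by (induction g) (auto simp: algebra_simps)

lemma int_eval_pcompose [simp]: "int_eval z (pcompose f g) = int_eval (int_eval z g) f"
  by (induction f) (auto simp: pcompose_pCons int_eval.hom_add int_eval.hom_mult)

lemma poly_of_int_poly_complex: "poly (of_int_poly g) z = int_eval z g"
  by (simp add: int_eval_def)

section \<open>Frobenius congruences modulo a prime\<close>

text \<open>The inner binomial coefficients are divisible by \<open>q\<close>. The ring is arbitrary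
  because both integers and integer polynomials occur below.\<close>

lemma freshman_dream_mod:
  fixes a b :: "'a :: comm_ring_1"
  assumes "prime q"
  shows "\<exists>k. (a + b) ^ q = a ^ q + b ^ q + of_nat q * k"
proof -
  have q: "q > 0" using assms prime_gt_0_nat by blast
  let ?t = "\<lambda>k. of_nat (q choose k) * a ^ k * b ^ (q - k)"
  have dv: "of_nat q dvd ?t k" if "k \<in> {0<..<q}" for k
  proof -
    have "q dvd q choose k"
      using assms that dvd_choose_prime[of k q] by auto
    then have "of_nat q dvd (of_nat (q choose k) :: 'a)"
      by (auto simp: dvd_def)
    then show ?thesis by (simp add: mult.assoc)
  qed
  have "(a + b) ^ q = (\<Sum>k\<le>q. ?t k)"
    by (rule binomial_ring)
  also have "{..q} = insert 0 (insert q {0<..<q})"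
    using q by auto
  also have "sum ?t (insert 0 (insert q {0<..<q})) = b ^ q + a ^ q + sum ?t {0<..<q}"
    using q by (simp add: add.assoc)
  finally have "(a + b) ^ q = a ^ q + b ^ q + sum ?t {0<..<q}" by (simp add: add.commute)
  moreover have "of_nat q dvd sum ?t {0<..<q}"
    by (rule dvd_sum) (use dv in auto)
  ultimately show ?thesis by (auto simp: dvd_def)
qed

text \<open>Fermat's little theorem, by induction from 0 in both directions with the binomial
  congruence.\<close>

lemma int_frobenius:
  assumes "prime q"
  shows "\<exists>k. (a::int) ^ q = a + int q * k"
proof (induction a rule: int_induct[where k = 0])
  case base
  then show ?case using prime_gt_0_nat[OF assms] by (intro exI[of _ 0]) simp
next
  case (step1 i)
  then obtain k where "i ^ q = i + int q * k" by blast
  moreover obtain l where "(i + 1) ^ q = i ^ q + 1 ^ q + int q * l"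
    using freshman_dream_mod[OF assms, of i 1] by auto
  ultimately have "(i + 1) ^ q = (i + 1) + int q * (k + l)"
    by (simp add: algebra_simps)
  then show ?case by blast
next
  case (step2 i)
  then obtain k where "i ^ q = i + int q * k" by blast
  moreover obtain l where "i ^ q = (i - 1) ^ q + 1 ^ q + int q * l"
    using freshman_dream_mod[OF assms, of "i - 1" 1] by auto
  ultimately have "(i - 1) ^ q = (i - 1) + int q * (k - l)"
    by (simp add: algebra_simps)
  then show ?case by blast
qed

text \<open>In Z[x], \<open>f(x^q)\<close> and \<open>f(x)^q\<close> agree modulo \<open>q\<close>:
  the binomial congruence splits off the constant coefficient, and Fermat's little theorem treats
  it.\<close>

lemma int_eval_frobenius:
  assumes "prime q"
  shows "\<exists>h. \<forall>z. int_eval (z ^ q) f = int_eval z f ^ q + of_nat q * int_eval z h"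
proof (induction f)
  case 0
  then show ?case using assms by (intro exI[of _ 0]) (auto simp: prime_gt_0_nat)
next
  case (pCons a f)
  then obtain h where h: "\<And>z. int_eval (z ^ q) f = int_eval z f ^ q + of_nat q * int_eval z h"
    by blast
  obtain k where k: "([:a:] + pCons 0 f) ^ q = [:a:] ^ q + pCons 0 f ^ q + of_nat q * k"
    using freshman_dream_mod[OF assms] by blast
  obtain c where c: "a ^ q = a + int q * c"
    using int_frobenius[OF assms] by blast
  \<comment> \<open>The witness is \<open>x^q * h - k - c\<close>: \<open>h\<close> comes from the
    induction hypothesis, \<open>k\<close> from the binomial congruence, \<open>c\<close> from
    Fermat's theorem for \<open>a\<close>.\<close>
  have "int_eval (z ^ q) (pCons a f) =
     int_eval z (pCons a f) ^ q + of_nat q * int_eval z (pCons 0 1 ^ q * h - k - [:c:])" for z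
  proof -
    have "int_eval z (pCons a f) ^ q = int_eval z (([:a:] + pCons 0 f) ^ q)"
      by (simp add: int_eval.hom_power)
    also have "\<dots> = of_int (a ^ q) + z ^ q * int_eval z f ^ q + of_nat q * int_eval z k"
      unfolding k by (simp add: int_eval.hom_add int_eval.hom_mult int_eval.hom_power power_mult_distrib int_eval.hom_of_nat)
    finally show ?thesis
      by (simp add: h c int_eval.hom_add int_eval.hom_minus int_eval.hom_mult int_eval.hom_power algebra_simps)
  qed
  then show ?case by blast
qed

section \<open>Primitive roots of unity and their minimal polynomials over the integers\<close>

text \<open>The order of \<open>z\<close> is exactly \<open>n\<close>; \<open>n > 0\<close> excludes
  numbers of infinite order, for which the equivalence holds with \<open>n = 0\<close>.\<close>

definition primitive_root :: "nat \<Rightarrow> complex \<Rightarrow> bool" where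
  "primitive_root n z \<longleftrightarrow> n > 0 \<and> (\<forall>k. z ^ k = 1 \<longleftrightarrow> n dvd k)"

lemma primitive_root_power:
  assumes "primitive_root n z" "coprime t n"
  shows "primitive_root n (z ^ t)"
  using assms unfolding primitive_root_def
  by (simp flip: power_mult add: coprime_commute coprime_dvd_mult_right_iff)

lemma primitive_root_nonzero: "primitive_root n z \<Longrightarrow> z \<noteq> 0"
  unfolding primitive_root_def by (metis dvd_refl gr_implies_not0 power_0_left zero_neq_one)

lemma primitive_root_power_eq_iff:
  assumes "primitive_root n z"
  shows "z ^ a = z ^ b \<longleftrightarrow> [a = b] (mod n)"
proof (induction a b rule: linorder_wlog)
  case (le a b)
  have "z ^ a = z ^ b \<longleftrightarrow> z ^ (b - a) = 1"
    using le primitive_root_nonzero[OF assms] by (auto simp: power_diff)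
  also have "\<dots> \<longleftrightarrow> n dvd b - a"
    using assms by (simp add: primitive_root_def)
  also have "\<dots> \<longleftrightarrow> [a = b] (mod n)"
    using le by (metis cong_altdef_nat cong_sym_eq)
  finally show ?case .
qed (auto simp: cong_sym_eq)

text \<open>A monic generator of the kernel of evaluation at \<open>z\<close>, that is, the minimal
  polynomial of an algebraic integer. Divisibility in Z[x] keeps polynomials over the rationals out
  of the development.\<close>

definition minimal_int_poly :: "complex \<Rightarrow> int poly \<Rightarrow> bool" where
  "minimal_int_poly z f \<longleftrightarrow> lead_coeff f = 1 \<and> (\<forall>g. int_eval z g = 0 \<longleftrightarrow> f dvd g)"

text \<open>Gauss's lemma is not needed here: pseudo-division by an annihilating polynomial of least degree
  and primality of \<open>f\<close> show that \<open>f\<close> itself has least degree.\<close>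

lemma prime_int_poly_dvd:
  assumes "prime_elem f" "lead_coeff f = 1" "int_eval z f = 0" "int_eval z g = 0"
  shows "f dvd g"
proof (cases "g = 0")
  case False
  define Z where "Z = (\<lambda>r. r \<noteq> 0 \<and> int_eval z r = 0)"
  have "Z f" using assms by (auto simp: Z_def)
  then obtain r where r: "Z r" "\<And>s. Z s \<Longrightarrow> degree r \<le> degree s"
    using arg_min_nat_lemma[of Z f degree] by blast
  have r0: "r \<noteq> 0" "int_eval z r = 0" using r by (auto simp: Z_def)
  have deg_r: "degree r \<noteq> 0"
  proof
    assume "degree r = 0"
    then obtain c where "r = [:c:]" by (metis degree_eq_zeroE)
    with r0 show False by simp
  qed
  obtain a q where aq: "a \<noteq> 0" "smult a f = r * q + pseudo_mod f r"
    using pseudo_mod(1)[OF r0(1)] by blast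
  have ev: "int_eval z (pseudo_mod f r) = 0"
    using arg_cong[OF aq(2), of "int_eval z"] r0 assms(3)
    by (simp add: int_eval.hom_add int_eval.hom_mult)
  have "pseudo_mod f r = 0"
  proof (rule ccontr)
    assume "pseudo_mod f r \<noteq> 0"
    with pseudo_mod(2)[OF r0(1), of f] have "degree (pseudo_mod f r) < degree r" by simp
    with r(2)[of "pseudo_mod f r"] ev \<open>pseudo_mod f r \<noteq> 0\<close> show False by (auto simp: Z_def)
  qed
  with aq have eq: "smult a f = r * q" by simp
  then have "f dvd r * q" by (metis dvd_refl dvd_smult)
  then have "f dvd r \<or> f dvd q" using assms(1) prime_elem_dvd_mult_iff by blast
  have "q \<noteq> 0" using eq aq assms by auto
  have dg: "degree f = degree r + degree q"
    using arg_cong[OF eq, of degree] aq(1) r0(1) \<open>q \<noteq> 0\<close> by (simp add: degree_mult_eq)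
  have "\<not> f dvd q"
    using dg deg_r \<open>q \<noteq> 0\<close> dvd_imp_degree_le[of f q] by auto
  with \<open>f dvd r \<or> f dvd q\<close> have "f dvd r" by blast
  then have deg_le: "degree f \<le> degree s" if "Z s" for s
    using r(2)[OF that] dvd_imp_degree_le r0(1) le_trans by blast
  have f0: "f \<noteq> 0" using assms by auto
  \<comment> \<open>For monic \<open>f\<close> the multiplier of pseudo-division is a power of 1, so
    this is ordinary division with remainder in Z[x].\<close>
  obtain a q where aq: "g = f * q + pseudo_mod g f"
    using pseudo_divmod[OF f0, of g] assms(2) unfolding pseudo_mod_def
    by (metis prod.collapse power_one smult_1_left)
  have ev: "int_eval z (pseudo_mod g f) = 0"
    using arg_cong[OF aq, of "int_eval z"] assms
    by (simp add: int_eval.hom_add int_eval.hom_mult)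
  have "pseudo_mod g f = 0"
    using deg_le[of "pseudo_mod g f"] pseudo_mod(2)[OF f0, of g] ev
    by (metis Z_def linorder_not_less)
  with aq show ?thesis by (metis add.right_neutral dvd_triv_left)
qed simp

text \<open>Some prime factor of \<open>P\<close> in Z[x] vanishes at \<open>z\<close>. Its leading
  coefficient divides that of \<open>P\<close>, which is 1, and is positive since the factor is
  normalized.\<close>

lemma minimal_int_poly_exists:
  assumes "int_eval z P = 0" "lead_coeff P = 1"
  obtains f where "minimal_int_poly z f" "f dvd P"
proof -
  have P0: "P \<noteq> 0" using assms by auto
  obtain f where f: "f \<in># prime_factorization P" "int_eval z f = 0"
  proof -
    have "P dvd prod_mset (prime_factorization P)"
      using prod_mset_prime_factorization_weak[OF P0] by (metis dvd_refl normalize_dvd_iff dvd_normalize_iff)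
    then have "int_eval z (prod_mset (prime_factorization P)) = 0"
      using assms by (auto simp: int_eval.hom_mult elim!: dvdE)
    moreover have "int_eval z (prod_mset A) = 0 \<Longrightarrow> \<exists>f\<in>#A. int_eval z f = 0" for A
      by (induction A) (auto simp: int_eval.hom_mult)
    ultimately show ?thesis using that by blast
  qed
  have pr: "prime f" and dv: "f dvd P" using f(1) by (auto simp: in_prime_factors_iff)
  have "lead_coeff f dvd 1"
    using dv assms(2) by (metis dvd_def dvd_triv_left lead_coeff_mult)
  moreover have "unit_factor f = 1"
    using normalize_prime[OF pr] normalize_mult_unit_factor[of f] P0 dv
    by (metis dvd_0_left mult_cancel_left1)
  then have "[:sgn (lead_coeff f):] = [:1:]"
    by (simp add: unit_factor_poly_def)
  then have "sgn (lead_coeff f) = 1"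
    unfolding pCons_eq_iff by blast
  ultimately have lc: "lead_coeff f = 1"
    by (metis abs_sgn mult.right_neutral zdvd1_eq)
  have "minimal_int_poly z f"
    unfolding minimal_int_poly_def
    using lc prime_int_poly_dvd[OF prime_imp_prime_elem[OF pr] lc f(2)] f(2)
    by (auto simp: int_eval.hom_mult elim!: dvdE)
  then show ?thesis using that dv by blast
qed

text \<open>By the Frobenius congruence, \<open>f(z\<^sup>q)\<close> is \<open>q\<close> times an element of \<open>\<int>[z]\<close>. If it is not \<open>0\<close>,
  then differentiating \<open>x\<^sup>n - 1 = f g\<close> at \<open>z\<^sup>q\<close> shows that it divides \<open>n\<close> in \<open>\<int>[z]\<close>, hence \<open>q\<close> divides \<open>n\<close>.\<close>

lemma minimal_int_poly_root_power:
  assumes z: "primitive_root n z" and f: "minimal_int_poly z f" and q: "prime q" "\<not> q dvd n"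
  shows "int_eval (z ^ q) f = 0"
proof (rule ccontr)
  assume neq: "int_eval (z ^ q) f \<noteq> 0"
  have n: "n > 0" using z by (simp add: primitive_root_def)
  have zn: "z ^ n = 1" using z by (simp add: primitive_root_def)
  have f_min: "int_eval z g = 0 \<longleftrightarrow> f dvd g" for g
    using f by (simp add: minimal_int_poly_def)
  have f0: "f \<noteq> 0" and lc: "lead_coeff f = 1" using f by (auto simp: minimal_int_poly_def)
  have "int_eval z (monom 1 n - 1) = 0" using zn by (simp add: int_eval.hom_minus)
  then obtain g where g: "monom 1 n - 1 = f * g" using f_min by (metis dvdE)
  have zqn: "(z ^ q) ^ n = 1"
    using zn unfolding power_mult[symmetric] mult.commute[of q] by (simp add: power_mult)
  have "int_eval (z ^ q) (f * g) = 0"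
    unfolding g[symmetric] using zqn by (simp add: int_eval.hom_minus)
  then have g0: "int_eval (z ^ q) g = 0" using neq by (simp add: int_eval.hom_mult)
  have "pderiv (monom 1 n - 1) = f * pderiv g + g * pderiv f"
    unfolding g by (rule pderiv_mult)
  then have "monom (int n) (n - 1) = f * pderiv g + g * pderiv f"
    by (simp add: pderiv_diff pderiv_monom)
  from arg_cong[OF this, of "int_eval (z ^ q)"]
  have "of_nat n * (z ^ q) ^ (n - 1) = int_eval (z ^ q) f * int_eval (z ^ q) (pderiv g)"
    using g0 by (simp add: int_eval.hom_add int_eval.hom_mult)
  then have "of_nat n * (z ^ q) ^ (n - 1) * z ^ q =
      int_eval (z ^ q) f * int_eval (z ^ q) (pderiv g) * z ^ q"
    by (rule arg_cong)
  moreover have "(z ^ q) ^ (n - 1) * z ^ q = 1"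
    using power_minus_mult[OF n, of "z ^ q"] zqn by simp
  ultimately have n_eq: "of_nat n = z ^ q * int_eval (z ^ q) f * int_eval (z ^ q) (pderiv g)"
    by (metis mult.assoc mult.commute mult.right_neutral)
  obtain h where h: "\<And>z. int_eval (z ^ q) f = int_eval z f ^ q + of_nat q * int_eval z h"
    using int_eval_frobenius[OF q(1)] by blast
  have fz: "int_eval z f = 0" using f_min by simp
  \<comment> \<open>Since \<open>f(z) = 0\<close>, the congruence leaves
    \<open>f(z^q) = q * h(z)\<close>. With \<open>g'(z^q)\<close> written as a polynomial in
    \<open>z\<close>, this gives \<open>n = q * k(z)\<close>.\<close>
  define k where "k = monom 1 q * h * pcompose (pderiv g) (monom 1 q)"
  have nk: "of_nat n = of_nat q * int_eval z k"
    using n_eq h[of z] fz prime_gt_0_nat[OF q(1)]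
    by (simp add: k_def int_eval.hom_mult algebra_simps)
  obtain b where b: "k = f * b + pseudo_mod k f"
    using pseudo_divmod[OF f0, of k] lc unfolding pseudo_mod_def
    by (metis prod.collapse power_one smult_1_left)
  \<comment> \<open>Below the degree of \<open>f\<close> a relation at \<open>z\<close> is an
    identity of polynomials, so constant coefficients can be compared.\<close>
  define r where "r = pseudo_mod k f"
  have deg_r: "r = 0 \<or> degree r < degree f" using pseudo_mod(2)[OF f0] by (simp add: r_def)
  have "int_eval z k = int_eval z r"
    using arg_cong[OF b, of "int_eval z"] fz by (simp add: r_def int_eval.hom_add int_eval.hom_mult)
  then have "int_eval z ([:int n:] - smult (int q) r) = 0"
    using nk by (simp add: int_eval.hom_minus)
  then have dv: "f dvd [:int n:] - smult (int q) r" using f_min by blast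
  have "degree f > 0"
  proof (rule ccontr)
    assume "\<not> degree f > 0"
    then obtain c where "f = [:c:]" by (metis degree_eq_zeroE gr0I)
    with f0 fz show False by simp
  qed
  then have "degree ([:int n:] - smult (int q) r) < degree f"
    using deg_r by (intro degree_diff_less) (auto intro: le_less_trans[OF degree_smult_le])
  then have "[:int n:] - smult (int q) r = 0"
    using dv dvd_imp_degree_le by (metis linorder_not_less)
  then have "int n = int q * coeff r 0"
    by (metis coeff_pCons_0 coeff_smult eq_iff_diff_eq_0)
  then have "int q dvd int n" by (metis dvd_triv_left)
  with q(2) show False by simp
qed

lemma primitive_root_minimal_int_poly:
  assumes "primitive_root n z"
  obtains f where "minimal_int_poly z f" "f dvd monom 1 n - 1"
proof (rule minimal_int_poly_exists)
  have n: "n > 0" using assms by (simp add: primitive_root_def)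
  show "int_eval z (monom 1 n - 1) = 0"
    using assms by (simp add: int_eval.hom_minus primitive_root_def)
  have "degree (monom 1 n - 1 :: int poly) = n"
    using n degree_add_eq_left[of "- 1" "monom (1::int) n"] by (simp add: degree_monom_eq)
  then show "lead_coeff (monom 1 n - 1 :: int poly) = 1"
    using n by simp
qed (use that in blast)

text \<open>The prime factors of \<open>t\<close> do not divide \<open>n\<close>, so they are
  applied one at a time; \<open>z\<close> varies in the induction because it is replaced by
  \<open>z ^ q\<close>. In substance this is the irreducibility of the cyclotomic
  polynomials.\<close>

lemma int_eval_conjugate:
  assumes "primitive_root n z" "coprime t n" "int_eval z g = 0"
  shows "int_eval (z ^ t) g = 0"
  using assms
proof (induction t arbitrary: z rule: less_induct)
  case (less t)
  consider "t = 0" | "t = 1" | "t > 1" by linarith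
  then show ?case
  proof cases
    case 1
    with less.prems have "n = 1" by simp
    then have "z ^ 1 = 1" using less.prems(1) by (simp only: primitive_root_def dvd_refl)
    with 1 less.prems show ?thesis by simp
  next
    case 3
    then obtain q where q: "prime q" "q dvd t" using prime_factor_nat by (metis less_irrefl)
    then obtain s where s: "t = q * s" by blast
    have cop: "coprime q n" "coprime s n" using less.prems(2) s by auto
    have "s < t" using s q(1) 3 prime_gt_1_nat[of q] by (cases "s = 0") auto
    have "\<not> q dvd n" using cop(1) q(1) coprime_absorb_left not_prime_unit by blast
    obtain f where f: "minimal_int_poly z f"
      using primitive_root_minimal_int_poly[OF less.prems(1)] by blast
    have "f dvd g" using f less.prems(3) by (simp add: minimal_int_poly_def)
    then have "int_eval (z ^ q) g = 0"
      using minimal_int_poly_root_power[OF less.prems(1) f q(1) \<open>\<not> q dvd n\<close>]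
      by (auto simp: int_eval.hom_mult elim!: dvdE)
    then have "int_eval ((z ^ q) ^ s) g = 0"
      by (intro less.IH[OF \<open>s < t\<close> primitive_root_power] less.prems cop)
    then show ?thesis by (simp add: s power_mult)
  qed (use less.prems in simp)
qed

text \<open>Raising to an inverse \<open>s\<close> of \<open>t\<close> modulo \<open>n\<close> leads
  back from \<open>z ^ t\<close> to \<open>z\<close>.\<close>

lemma int_eval_conjugate_iff:
  assumes "primitive_root n z" "coprime t n"
  shows "int_eval (z ^ t) g = 0 \<longleftrightarrow> int_eval z g = 0"
proof
  assume *: "int_eval (z ^ t) g = 0"
  obtain s where s: "[t * s = 1] (mod n)"
    using cong_solve_coprime_nat[OF assms(2)] by auto
  then have "coprime s n"
    by (metis cong_imp_coprime cong_sym coprime_1_left coprime_mult_left_iff)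
  then have "int_eval ((z ^ t) ^ s) g = 0"
    using int_eval_conjugate[OF primitive_root_power[OF assms]] * by blast
  moreover have "(z ^ t) ^ s = z ^ 1"
    unfolding power_mult[symmetric] primitive_root_power_eq_iff[OF assms(1)] using s .
  ultimately show "int_eval z g = 0" by simp
qed (use int_eval_conjugate assms in blast)

text \<open>The powers of \<open>z\<close> with exponents below \<open>n\<close> are distinct, and
  there are exactly \<open>n\<close> complex \<open>n\<close>-th roots of unity.\<close>

lemma root_of_unity_is_power:
  assumes "primitive_root n z" "x ^ n = 1"
  obtains i where "x = z ^ i"
proof -
  have n: "n > 0" using assms by (simp add: primitive_root_def)
  have inj: "inj_on ((^) z) {..<n}"
    by (auto simp: inj_on_def primitive_root_power_eq_iff[OF assms(1)] cong_less_modulus_unique_nat)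
  have sub: "(^) z ` {..<n} \<subseteq> {x. x ^ n = 1}"
    using assms(1) by (auto simp: primitive_root_def power_mult[symmetric] mult.commute[of _ n])
  have "card ((^) z ` {..<n}) = card {x::complex. x ^ n = 1}"
    using card_image[OF inj] card_roots_unity_eq[OF n] by simp
  then have "(^) z ` {..<n} = {x. x ^ n = 1}"
    using sub finite_roots_unity[of n] n by (intro card_subset_eq) auto
  then show ?thesis using assms(2) that by blast
qed

text \<open>Reduce \<open>G\<close> modulo the minimal polynomial of \<open>z\<close>. All roots of the latter are primitive, so the
  remainder minus \<open>a\<close> has more roots than its degree allows.\<close>

lemma int_eval_invariant_imp_int:
  assumes z: "primitive_root n z" and G: "\<And>u. coprime u n \<Longrightarrow> int_eval (z ^ u) G = a"
  shows "a \<in> \<int>"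
proof -
  obtain f where f: "minimal_int_poly z f" and "f dvd monom 1 n - 1"
    using primitive_root_minimal_int_poly[OF z] by blast
  then obtain g where g: "monom 1 n - 1 = f * g" by blast
  have n: "n > 0" using z by (simp add: primitive_root_def)
  have f_min: "int_eval z g = 0 \<longleftrightarrow> f dvd g" for g
    using f by (simp add: minimal_int_poly_def)
  have f0: "f \<noteq> 0" and lc: "lead_coeff f = 1" using f by (auto simp: minimal_int_poly_def)
  have fz: "int_eval z f = 0" using f_min by simp
  obtain b where b: "G = f * b + pseudo_mod G f"
    using pseudo_divmod[OF f0, of G] lc unfolding pseudo_mod_def
    by (metis prod.collapse power_one smult_1_left)
  define r where "r = pseudo_mod G f"
  have deg_r: "r = 0 \<or> degree r < degree f" using pseudo_mod(2)[OF f0] by (simp add: r_def)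
  define F where "F = (of_int_poly f :: complex poly)"
  define R where "R = of_int_poly r - [:a:]"
  have F_eval: "poly F x = int_eval x f" for x by (simp add: F_def int_eval_def)
  have pow: "x ^ n = 1" if "poly F x = 0" for x
    using that arg_cong[OF g, of "int_eval x"]
    by (simp add: F_eval int_eval.hom_minus int_eval.hom_mult)
  have R0: "poly R x = 0" if x: "poly F x = 0" for x
  proof -
    obtain i where i: "x = z ^ i" using root_of_unity_is_power[OF z pow[OF x]] by blast
    \<comment> \<open>Otherwise \<open>x ^ m = 1\<close> for a proper divisor \<open>m\<close> of
      \<open>n\<close>, and the minimal polynomial \<open>f'\<close> of \<open>x\<close> divides
      both \<open>f\<close> and the polynomial \<open>monom 1 m - 1\<close>. As
      \<open>f(z) = 0\<close>, either \<open>f'\<close> or the cofactor \<open>c\<close> vanishes at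
      \<open>z\<close>; the latter would make \<open>f'\<close> a unit, so \<open>f\<close> divides
      \<open>f'\<close> and \<open>z ^ m = 1\<close>.\<close>
    have "coprime i n"
    proof (rule ccontr)
      assume "\<not> coprime i n"
      then obtain d where d: "d dvd i" "d dvd n" "d > 1"
        using n by (metis coprime_iff_gcd_eq_1 gcd_dvd1 gcd_dvd2 gcd_eq_0_iff gr_implies_not0 less_one linorder_neqE_nat)
      then obtain m where m: "n = d * m" by blast
      have m0: "0 < m" "m < n" using m n d by auto
      have "int_eval x (monom 1 m - 1) = 0"
        using z m d by (auto simp: int_eval.hom_minus i primitive_root_def simp flip: power_mult)
      moreover obtain f' where f': "minimal_int_poly x f'" "f' dvd f"
        using minimal_int_poly_exists[of x f] x lc by (auto simp: F_eval)
      ultimately have "f' dvd monom 1 m - 1" by (simp add: minimal_int_poly_def)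
      obtain c where c: "f = f' * c" using f'(2) by blast
      have "int_eval z f' = 0 \<or> int_eval z c = 0"
        using fz by (simp add: c int_eval.hom_mult)
      moreover have "\<not> f dvd c"
      proof
        assume "f dvd c"
        then have "f * f' dvd f * 1" using c by (metis dvd_refl mult.commute mult.right_neutral mult_dvd_mono)
        then have "f' dvd 1" using f0 by (subst (asm) dvd_mult_cancel_left) simp
        then have "int_eval x 1 = 0" using f'(1) by (metis minimal_int_poly_def)
        then show False by simp
      qed
      ultimately have "f dvd f'" using f_min by blast
      then have "int_eval z (monom 1 m - 1) = 0"
        using \<open>f' dvd monom 1 m - 1\<close> f_min dvd_trans by blast
      then have "n dvd m" using z by (simp add: primitive_root_def int_eval.hom_minus)
      with m0 show False using nat_dvd_not_less by blast
    qed
    then have "int_eval x G = a" using G i by blast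
    moreover have "int_eval x G = int_eval x r"
      using arg_cong[OF b, of "int_eval x"] x by (simp add: F_eval r_def int_eval.hom_add int_eval.hom_mult)
    ultimately show ?thesis by (simp add: R_def poly_of_int_poly_complex)
  qed
  have F0: "F \<noteq> 0" using f0 by (simp add: F_def)
  \<comment> \<open>A multiple root of \<open>F\<close> would be one of
    \<open>monom 1 n - 1\<close>, whose derivative vanishes at no \<open>n\<close>-th root of unity.
    Hence \<open>F\<close> has as many roots as its degree.\<close>
  have "rsquarefree F"
    unfolding rsquarefree_roots
  proof (intro allI notI)
    fix x assume *: "poly F x = 0 \<and> poly (pderiv F) x = 0"
    have "pderiv (of_int_poly (monom 1 n - 1)) = F * pderiv (of_int_poly g) + of_int_poly g * pderiv F"
      unfolding g F_def by (simp add: of_int_poly_hom.hom_mult pderiv_mult)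
    then have "poly (pderiv (monom 1 n - 1)) x = 0"
      using * by (simp add: of_int_poly_hom.hom_minus map_poly_monom)
    then have "x = 0" using n by (simp add: pderiv_diff pderiv_monom poly_monom)
    with pow[of x] * n show False by (simp add: power_0_left)
  qed
  then have card_F: "card {x. poly F x = 0} = degree f"
    using rsquarefree_card_degree[OF F0] by (simp add: F_def)
  have deg_f: "degree f > 0"
  proof (rule ccontr)
    assume "\<not> degree f > 0"
    then obtain c where "f = [:c:]" by (metis degree_eq_zeroE gr0I)
    with f0 fz show False by simp
  qed
  have "R = 0"
  proof (rule ccontr)
    assume R: "R \<noteq> 0"
    have "degree f \<le> card {x. poly R x = 0}"
      unfolding card_F[symmetric] using R0 poly_roots_finite[OF R] by (intro card_mono) auto
    also have "\<dots> \<le> degree R" by (rule card_poly_roots_bound[OF R])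
    also have "\<dots> < degree f"
      unfolding R_def using deg_r deg_f by (intro degree_diff_less) auto
    finally show False by simp
  qed
  then have "a = of_int (coeff r 0)"
    by (metis R_def coeff_map_poly coeff_pCons_0 eq_iff_diff_eq_0 of_int_0)
  then show ?thesis by simp
qed

section \<open>Conjugates and primitive elements\<close>

text \<open>The previous criterion, applied to each coefficient. It gives integer coefficients to
  products and sums over all conjugates.\<close>

lemma int_poly_poly_invariant:
  fixes \<Q> :: "int poly poly"
  assumes z: "primitive_root n z"
    and inv: "\<And>u. coprime u n \<Longrightarrow> map_poly (int_eval (z ^ u)) \<Q> = Q"
  obtains q where "of_int_poly q = Q"
proof
  have "coeff Q k \<in> \<int>" for k
  proof (rule int_eval_invariant_imp_int[OF z])
    fix u assume "coprime u n"
    from inv[OF this] show "int_eval (z ^ u) (coeff \<Q> k) = coeff Q k"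
      by (metis coeff_map_poly int_eval_0)
  qed
  \<comment> \<open>The floor of the real part only reads off the integer that the coefficient is
    known to be.\<close>
  then have "of_int \<lfloor>Re (coeff Q k)\<rfloor> = coeff Q k" for k
    by (metis Ints_cases Re_complex_of_real floor_of_int of_real_of_int_eq)
  then show "of_int_poly (map_poly (\<lambda>x. \<lfloor>Re x\<rfloor>) Q) = Q"
    by (intro poly_eqI) (simp add: coeff_map_poly)
qed

text \<open>A set, so that coinciding values count once; its cardinality turns out to be the degree
  of \<open>A(z)\<close>.\<close>

definition conjugates :: "nat \<Rightarrow> complex \<Rightarrow> int poly \<Rightarrow> complex set" where
  "conjugates n z A = {int_eval (z ^ t) A |t. coprime t n}"

lemma finite_conjugates:
  assumes "primitive_root n z"
  shows "finite (conjugates n z A)"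
proof (rule finite_subset)
  have n: "n > 0" using assms by (simp add: primitive_root_def)
  show "conjugates n z A \<subseteq> (\<lambda>t. int_eval (z ^ t) A) ` {..<n}"
  proof
    fix x assume "x \<in> conjugates n z A"
    then obtain t where "x = int_eval (z ^ t) A" by (auto simp: conjugates_def)
    moreover have "z ^ t = z ^ (t mod n)"
      by (simp add: primitive_root_power_eq_iff[OF assms])
    ultimately show "x \<in> (\<lambda>t. int_eval (z ^ t) A) ` {..<n}"
      using n by auto
  qed
qed simp

lemma int_eval_in_conjugates: "int_eval z A \<in> conjugates n z A"
  unfolding conjugates_def by (intro CollectI exI[of _ 1]) simp

text \<open>\<open>A(x^s) - A(x^t)\<close> is a single integer polynomial, and replacing
  \<open>z\<close> by \<open>z ^ u\<close> does not affect whether it vanishes.\<close>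

lemma conjugate_eq_iff:
  assumes "primitive_root n z" "coprime u n"
  shows "int_eval (z ^ (u * s)) A = int_eval (z ^ (u * t)) A \<longleftrightarrow>
         int_eval (z ^ s) A = int_eval (z ^ t) A"
proof -
  define H where "H = pcompose A (monom 1 s) - pcompose A (monom 1 t)"
  have H: "int_eval w H = int_eval (w ^ s) A - int_eval (w ^ t) A" for w
    by (simp add: H_def int_eval.hom_minus)
  show ?thesis
    using int_eval_conjugate_iff[OF assms, of H] by (simp add: H power_mult)
qed

text \<open>Hence expressions that are symmetric in the pairs \<open>(A(z\<^sup>t), B(z\<^sup>t))\<close> are invariant under
  \<open>z \<mapsto> z\<^sup>u\<close>.\<close>

lemma conjugates_permutation:
  assumes z: "primitive_root n z" and u: "coprime u n"
    and \<tau>: "\<And>c. c \<in> conjugates n z A \<Longrightarrow> coprime (\<tau> c) n \<and> int_eval (z ^ \<tau> c) A = c"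
  shows "bij_betw (\<lambda>c. int_eval (z ^ (u * \<tau> c)) A) (conjugates n z A) (conjugates n z A)"
proof -
  let ?\<pi> = "\<lambda>c. int_eval (z ^ (u * \<tau> c)) A" and ?C = "conjugates n z A"
  have "inj_on ?\<pi> ?C"
    using \<tau> by (auto simp: inj_on_def conjugate_eq_iff[OF z u])
  moreover have "?\<pi> ` ?C \<subseteq> ?C"
    using \<tau> u by (force simp: conjugates_def)
  ultimately show ?thesis
    using finite_conjugates[OF z] by (simp add: bij_betw_def endo_inj_surj)
qed

text \<open>With an exponent chosen for each conjugate, expressions over the set of conjugates lift
  to polynomials with coefficients in Z[x].\<close>

lemma conjugates_choice:
  obtains \<tau> where "\<And>c. c \<in> conjugates n z A \<Longrightarrow> coprime (\<tau> c) n \<and> int_eval (z ^ \<tau> c) A = c"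
proof -
  have "\<exists>t. coprime t n \<and> int_eval (z ^ t) A = c" if "c \<in> conjugates n z A" for c
    using that by (auto simp: conjugates_def)
  then show ?thesis using that by metis
qed

lemma map_poly_int_eval_prod:
  "map_poly (int_eval z) (\<Prod>i\<in>I. f i) = (\<Prod>i\<in>I. map_poly (int_eval z) (f i))"
proof -
  interpret map_poly_comm_ring_hom "int_eval z" ..
  show ?thesis by (rule hom_prod)
qed

lemma map_poly_int_eval_sum:
  "map_poly (int_eval z) (\<Sum>i\<in>I. f i) = (\<Sum>i\<in>I. map_poly (int_eval z) (f i))"
proof -
  interpret map_poly_comm_ring_hom "int_eval z" ..
  show ?thesis by (rule hom_sum)
qed

lemma map_poly_int_eval_pCons:
  "map_poly (int_eval z) (pCons a f) = pCons (int_eval z a) (map_poly (int_eval z) f)"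
  by (rule int_eval.map_poly_pCons_hom)

lemma map_poly_int_eval_smult:
  "map_poly (int_eval z) (smult a f) = smult (int_eval z a) (map_poly (int_eval z) f)"
  by (rule poly_eqI) (simp add: coeff_map_poly int_eval.hom_mult)

text \<open>The product of the linear factors of all conjugates is invariant, hence integral, and
  bounds the degree from above. All conjugates are roots of \<open>f\<close>, which bounds it from
  below.\<close>

lemma minimal_int_poly_conjugates:
  assumes z: "primitive_root n z"
  obtains f where "minimal_int_poly (int_eval z A) f" "degree f = card (conjugates n z A)"
proof -
  define C where "C = conjugates n z A"
  have fin: "finite C" using finite_conjugates[OF z] by (simp add: C_def)
  obtain \<tau> where \<tau>: "\<And>c. c \<in> C \<Longrightarrow> coprime (\<tau> c) n \<and> int_eval (z ^ \<tau> c) A = c"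
    using conjugates_choice unfolding C_def by blast
  define M where "M = (\<Prod>c\<in>C. [:- c, 1:])"
  \<comment> \<open>The lift of \<open>M\<close>: evaluating its coefficients at
    \<open>z ^ u\<close> only permutes the linear factors.\<close>
  define \<M> where "\<M> = (\<Prod>c\<in>C. [:- pcompose A (monom 1 (\<tau> c)), 1:])"
  have "map_poly (int_eval (z ^ u)) \<M> = M" if u: "coprime u n" for u
  proof -
    define \<pi> where "\<pi> = (\<lambda>c. int_eval (z ^ (u * \<tau> c)) A)"
    have \<pi>: "bij_betw \<pi> C C"
      using conjugates_permutation[OF z u \<tau>[unfolded C_def]] by (simp add: C_def \<pi>_def)
    have "map_poly (int_eval (z ^ u)) \<M> = (\<Prod>c\<in>C. [:- \<pi> c, 1:])"
      by (simp add: \<M>_def \<pi>_def map_poly_int_eval_prod map_poly_int_eval_pCons int_eval.hom_uminus power_mult)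
    also have "\<dots> = M"
      unfolding M_def by (rule prod.reindex_bij_betw[OF \<pi>])
    finally show ?thesis .
  qed
  from int_poly_poly_invariant[OF z this] obtain m where m: "of_int_poly m = M" by blast
  have deg_M: "degree M = card C" unfolding M_def
    by (subst degree_prod_sum_eq) auto
  have "lead_coeff M = 1" unfolding M_def lead_coeff_prod by simp
  then have lc: "lead_coeff m = 1" and deg_m: "degree m = card C"
    using m deg_M by (metis of_int_hom.degree_map_poly_hom of_int_hom.coeff_map_poly_hom of_int_eq_1_iff,
      metis of_int_hom.degree_map_poly_hom)
  have "int_eval (int_eval z A) m = 0"
    using int_eval_in_conjugates[of z A n] fin
    unfolding int_eval_def[of "int_eval z A"] m by (auto simp: M_def poly_prod C_def)
  then obtain f where f: "minimal_int_poly (int_eval z A) f" "f dvd m"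
    using minimal_int_poly_exists lc by metis
  have f0: "f \<noteq> 0" using f by (auto simp: minimal_int_poly_def)
  have "m \<noteq> 0" using lc by auto
  then have "degree f \<le> card C" using f(2) deg_m dvd_imp_degree_le by metis
  moreover have "card C \<le> degree f"
  proof -
    have "int_eval c f = 0" if "c \<in> C" for c
    proof -
      from that obtain t where t: "coprime t n" "c = int_eval (z ^ t) A"
        by (auto simp: C_def conjugates_def)
      have "int_eval z (pcompose f A) = 0"
        using f by (auto simp: minimal_int_poly_def)
      then have "int_eval (z ^ t) (pcompose f A) = 0"
        using int_eval_conjugate[OF z t(1)] by blast
      then show ?thesis by (simp add: t)
    qed
    then have "C \<subseteq> {x. poly (of_int_poly f) x = 0}" by (auto simp: poly_of_int_poly_complex)
    then have "card C \<le> card {x::complex. poly (of_int_poly f) x = 0}"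
      using f0 by (intro card_mono poly_roots_finite) auto
    also have "\<dots> \<le> degree (of_int_poly f :: complex poly)"
      using f0 by (intro card_poly_roots_bound) auto
    finally show ?thesis by simp
  qed
  ultimately show ?thesis using that f(1) by (simp add: C_def)
qed

text \<open>The witness is the numerator of the polynomial that interpolates the conjugates of
  \<open>B(z)\<close> at those of \<open>A(z)\<close>; it has integer coefficients since it is invariant.\<close>

lemma lagrange_numerator:
  assumes z: "primitive_root n z"
    and dep: "\<And>s t. \<lbrakk>coprime s n; coprime t n; int_eval (z ^ s) A = int_eval (z ^ t) A\<rbrakk>
      \<Longrightarrow> int_eval (z ^ s) B = int_eval (z ^ t) B"
  shows "\<exists>N. int_eval (int_eval z A) N =
    int_eval z B * (\<Prod>d\<in>conjugates n z A - {int_eval z A}. int_eval z A - d)"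
proof -
  define C where "C = conjugates n z A"
  define \<alpha> where "\<alpha> = int_eval z A"
  have fin: "finite C" using finite_conjugates[OF z] by (simp add: C_def)
  have \<alpha>: "\<alpha> \<in> C" by (simp add: C_def \<alpha>_def int_eval_in_conjugates)
  obtain \<tau> where \<tau>: "\<And>c. c \<in> C \<Longrightarrow> coprime (\<tau> c) n \<and> int_eval (z ^ \<tau> c) A = c"
    using conjugates_choice unfolding C_def by blast
  define \<beta> where "\<beta> = (\<lambda>c. int_eval (z ^ \<tau> c) B)"
  define N where "N = (\<Sum>c\<in>C. [:\<beta> c:] * (\<Prod>d\<in>C - {c}. [:- d, 1:]))"
  define \<N> where "\<N> = (\<Sum>c\<in>C. [:pcompose B (monom 1 (\<tau> c)):] *
    (\<Prod>d\<in>C - {c}. [:- pcompose A (monom 1 (\<tau> d)), 1:]))"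
  have "map_poly (int_eval (z ^ u)) \<N> = N" if u: "coprime u n" for u
  proof -
    define \<pi> where "\<pi> = (\<lambda>c. int_eval (z ^ (u * \<tau> c)) A)"
    have \<pi>: "bij_betw \<pi> C C"
      using conjugates_permutation[OF z u \<tau>[unfolded C_def]] by (simp add: C_def \<pi>_def)
    \<comment> \<open>By \<open>dep\<close>, the value of \<open>B\<close> depends on the conjugate
      of \<open>A(z)\<close> alone and not on the exponent chosen for it.\<close>
    have \<beta>: "int_eval (z ^ (u * \<tau> c)) B = \<beta> (\<pi> c)" if "c \<in> C" for c
    proof -
      have "\<pi> c \<in> C" using \<pi> that by (auto simp: bij_betw_def)
      from \<tau>[OF this] \<tau>[OF that] u show ?thesis
        unfolding \<beta>_def by (intro dep) (auto simp: \<pi>_def)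
    qed
    have "map_poly (int_eval (z ^ u)) \<N> =
        (\<Sum>c\<in>C. [:int_eval (z ^ (u * \<tau> c)) B:] * (\<Prod>d\<in>C - {c}. [:- \<pi> d, 1:]))"
      by (simp add: \<N>_def \<pi>_def map_poly_int_eval_prod map_poly_int_eval_pCons map_poly_int_eval_sum
          map_poly_int_eval_smult int_eval.hom_uminus power_mult)
    also have "\<dots> = (\<Sum>c\<in>C. [:\<beta> (\<pi> c):] * (\<Prod>d\<in>C - {\<pi> c}. [:- d, 1:]))"
    proof (rule sum.cong)
      fix c assume c: "c \<in> C"
      have "bij_betw \<pi> (C - {c}) (C - {\<pi> c})"
        using \<pi> c inj_on_image_set_diff[of \<pi> C C "{c}"] inj_on_subset[of \<pi> C "C - {c}"]
        by (auto simp: bij_betw_def)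
      then have "(\<Prod>d\<in>C - {c}. [:- \<pi> d, 1:]) = (\<Prod>d\<in>C - {\<pi> c}. [:- d, 1:])"
        by (rule prod.reindex_bij_betw)
      then show "[:int_eval (z ^ (u * \<tau> c)) B:] * (\<Prod>d\<in>C - {c}. [:- \<pi> d, 1:]) =
        [:\<beta> (\<pi> c):] * (\<Prod>d\<in>C - {\<pi> c}. [:- d, 1:])"
        by (simp only: \<beta>[OF c])
    qed simp
    also have "\<dots> = N"
      unfolding N_def by (rule sum.reindex_bij_betw[OF \<pi>])
    finally show ?thesis .
  qed
  from int_poly_poly_invariant[OF z this] obtain m where m: "of_int_poly m = N" by blast
  \<comment> \<open>The exponent \<open>\<tau> \<alpha>\<close> may differ from 1, but by
    \<open>dep\<close> it gives the same value of \<open>B\<close>.\<close>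
  have "\<beta> \<alpha> = int_eval (z ^ 1) B"
    unfolding \<beta>_def using \<tau>[OF \<alpha>] by (intro dep) (auto simp: \<alpha>_def)
  \<comment> \<open>Every summand with \<open>c \<noteq> \<alpha>\<close> contains the factor
    \<open>\<alpha> - \<alpha>\<close>.\<close>
  moreover have "poly N \<alpha> = (\<Sum>c\<in>C. if c = \<alpha> then \<beta> \<alpha> * (\<Prod>d\<in>C - {\<alpha>}. \<alpha> - d) else 0)"
    unfolding N_def poly_sum
  proof (rule sum.cong)
    fix c assume "c \<in> C"
    then show "poly ([:\<beta> c:] * (\<Prod>d\<in>C - {c}. [:- d, 1:])) \<alpha> =
      (if c = \<alpha> then \<beta> \<alpha> * (\<Prod>d\<in>C - {\<alpha>}. \<alpha> - d) else 0)"
      using \<alpha> fin by (auto simp: poly_prod)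
  qed simp
  ultimately have "int_eval \<alpha> m = int_eval z B * (\<Prod>d\<in>C - {\<alpha>}. \<alpha> - d)"
    unfolding int_eval_def[of \<alpha>] m using \<alpha> fin by simp
  then show ?thesis unfolding C_def \<alpha>_def by blast
qed

text \<open>The numerator for the constant 1 expresses the common product itself as a polynomial in
  \<open>A(z)\<close>. The product is nonzero because \<open>A(z)\<close> is left out of it, so it
  can serve as the denominator of \<open>B(z)\<close>.\<close>

lemma primitive_element:
  assumes z: "primitive_root n z"
    and dep: "\<And>s t. \<lbrakk>coprime s n; coprime t n; int_eval (z ^ s) A = int_eval (z ^ t) A\<rbrakk>
      \<Longrightarrow> int_eval (z ^ s) B = int_eval (z ^ t) B"
  obtains N D where "int_eval (int_eval z A) D \<noteq> 0"
    "int_eval z B * int_eval (int_eval z A) D = int_eval (int_eval z A) N"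
proof -
  obtain N where N: "int_eval (int_eval z A) N =
      int_eval z B * (\<Prod>d\<in>conjugates n z A - {int_eval z A}. int_eval z A - d)"
    using lagrange_numerator[OF z dep] by blast
  obtain D where D: "int_eval (int_eval z A) D =
      int_eval z 1 * (\<Prod>d\<in>conjugates n z A - {int_eval z A}. int_eval z A - d)"
    using lagrange_numerator[OF z, of A 1] by auto
  show ?thesis
    using that[of D N] N D finite_conjugates[OF z, of A] by (auto simp: prod_zero_iff)
qed

section \<open>Generated subfields of the complex numbers\<close>

lemma complex_ring_simps [simp]:
  "carrier complex_ring = UNIV"
  "x \<otimes>\<^bsub>complex_ring\<^esub> y = x * y" "x \<oplus>\<^bsub>complex_ring\<^esub> y = x + y"
  "\<one>\<^bsub>complex_ring\<^esub> = 1" "\<zero>\<^bsub>complex_ring\<^esub> = 0"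
  by (simp_all add: ring_of_type_algebra_def)

lemma complex_ring_field: "field complex_ring"
  by (rule field_from_type_algebra)

lemma complex_ring_a_inv [simp]: "\<ominus>\<^bsub>complex_ring\<^esub> x = - x"
proof -
  interpret cr: field complex_ring by (rule complex_ring_field)
  show ?thesis by (rule cr.minus_equality) auto
qed

lemma complex_ring_m_inv [simp]: "x \<noteq> 0 \<Longrightarrow> inv\<^bsub>complex_ring\<^esub> x = inverse x"
proof -
  interpret cr: field complex_ring by (rule complex_ring_field)
  assume "x \<noteq> 0"
  then show ?thesis by (intro cr.comm_inv_char) auto
qed

text \<open>The ring Q[\<alpha>], with one common denominator so that integer polynomials
  suffice.\<close>

definition rat_adjoin :: "complex \<Rightarrow> complex set" where
  "rat_adjoin \<alpha> = {int_eval \<alpha> g / of_int m |g m. m \<noteq> 0}"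

lemma rat_adjoinI: "m \<noteq> 0 \<Longrightarrow> x * of_int m = int_eval \<alpha> g \<Longrightarrow> x \<in> rat_adjoin \<alpha>"
  unfolding rat_adjoin_def by (intro CollectI exI[of _ g] exI[of _ m]) (auto simp: field_simps)

lemma rat_adjoinE:
  assumes "x \<in> rat_adjoin \<alpha>"
  obtains g m where "m \<noteq> 0" "x = int_eval \<alpha> g / of_int m"
  using assms by (auto simp: rat_adjoin_def)

text \<open>A multiple of \<open>g(\<alpha>)\<close> whose representing polynomial has least degree is constant.\<close>

lemma minimal_int_poly_invert:
  assumes f: "minimal_int_poly \<alpha> f" and g: "int_eval \<alpha> g \<noteq> 0"
  obtains h m where "m \<noteq> 0" "int_eval \<alpha> g * int_eval \<alpha> h = of_int m"
proof -
  have f_min: "int_eval \<alpha> g = 0 \<longleftrightarrow> f dvd g" for g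
    using f by (simp add: minimal_int_poly_def)
  have f0: "f \<noteq> 0" and lc: "lead_coeff f = 1" using f by (auto simp: minimal_int_poly_def)
  define Z where "Z = (\<lambda>r. int_eval \<alpha> r \<noteq> 0 \<and> (\<exists>h. int_eval \<alpha> r = int_eval \<alpha> g * int_eval \<alpha> h))"
  have "Z g" using g by (auto simp: Z_def intro: exI[of _ 1])
  then obtain r where r: "Z r" "\<And>s. Z s \<Longrightarrow> degree r \<le> degree s"
    using arg_min_nat_lemma[of Z g degree] by blast
  have r0: "r \<noteq> 0" using r(1) by (auto simp: Z_def)
  obtain h where h: "int_eval \<alpha> r = int_eval \<alpha> g * int_eval \<alpha> h" using r(1) by (auto simp: Z_def)
  obtain b where b: "r = f * b + pseudo_mod r f"
    using pseudo_divmod[OF f0, of r] lc unfolding pseudo_mod_def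
    by (metis prod.collapse power_one smult_1_left)
  have "int_eval \<alpha> (pseudo_mod r f) = int_eval \<alpha> r"
    using arg_cong[OF b, of "int_eval \<alpha>"] f_min[of f] by (simp add: int_eval.hom_add int_eval.hom_mult)
  then have Zm: "Z (pseudo_mod r f)" using r(1) by (simp add: Z_def)
  then have "pseudo_mod r f \<noteq> 0" by (auto simp: Z_def)
  then have deg: "degree r < degree f"
    using r(2)[OF Zm] pseudo_mod(2)[OF f0, of r] by simp
  \<comment> \<open>The remainder of \<open>f\<close> modulo \<open>r\<close> again has a multiple
    of \<open>g(\<alpha>)\<close> as its value, so by the choice of \<open>r\<close> it
    vanishes.\<close>
  obtain c q where c: "c \<noteq> 0" "smult c f = r * q + pseudo_mod f r"
    using pseudo_mod(1)[OF r0] by blast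
  define s where "s = pseudo_mod f r"
  have deg_s: "s = 0 \<or> degree s < degree r" using pseudo_mod(2)[OF r0] by (simp add: s_def)
  have ev: "int_eval \<alpha> s = int_eval \<alpha> g * int_eval \<alpha> (- (h * q))"
    using arg_cong[OF c(2), of "int_eval \<alpha>"] f_min[of f] h
    by (simp add: s_def int_eval.hom_add int_eval.hom_mult int_eval.hom_uminus eq_neg_iff_add_eq_0 mult.assoc add.commute)
  have s_eval: "int_eval \<alpha> s = 0"
  proof (rule ccontr)
    assume *: "int_eval \<alpha> s \<noteq> 0"
    then have "Z s" using ev unfolding Z_def by blast
    moreover have "s \<noteq> 0" using * by auto
    ultimately show False using r(2)[of s] deg_s by simp
  qed
  then have "f dvd s" using f_min by blast
  then have s0: "s = 0" using deg_s deg dvd_imp_degree_le by (metis leD less_trans)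
  have "int_eval \<alpha> r * int_eval \<alpha> q = 0"
    using arg_cong[OF c(2), of "int_eval \<alpha>"] f_min[of f] s_eval
    by (simp add: s_def int_eval.hom_add int_eval.hom_mult)
  \<comment> \<open>From \<open>r * q = c * f\<close> and \<open>r(\<alpha>) \<noteq> 0\<close>, the
    factor \<open>f\<close> lies in \<open>q\<close>; cancelling it shows that \<open>r\<close>
    divides the constant \<open>c\<close>.\<close>
  then have "f dvd q" using r(1) f_min by (simp add: Z_def)
  then obtain k where k: "q = f * k" by blast
  have "f * [:c:] = f * (r * k)"
    using c(2) s0 by (simp add: s_def k mult.left_commute)
  then have "[:c:] = r * k" using f0 by (metis mult_left_cancel)
  then have "int_eval \<alpha> (r * k) = of_int c" by (metis int_eval_pCons int_eval_0 mult_zero_right add.right_neutral)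
  then have "int_eval \<alpha> g * int_eval \<alpha> (h * k) = of_int c"
    by (simp add: int_eval.hom_mult h mult.assoc)
  with c(1) that show ?thesis by blast
qed

text \<open>A multiple of \<open>D(\<alpha>)\<close> is a nonzero integer, which replaces
  \<open>D(\<alpha>)\<close> as the denominator.\<close>

lemma rat_adjoin_divide:
  assumes f: "minimal_int_poly \<alpha> f" and D: "int_eval \<alpha> D \<noteq> 0" "x * int_eval \<alpha> D = int_eval \<alpha> N"
  shows "x \<in> rat_adjoin \<alpha>"
proof -
  obtain h m where h: "m \<noteq> 0" "int_eval \<alpha> D * int_eval \<alpha> h = of_int m"
    using minimal_int_poly_invert[OF f D(1)] by blast
  have "x * of_int m = int_eval \<alpha> (N * h)"
    by (simp add: int_eval.hom_mult flip: h(2) D(2))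
  then show ?thesis by (rule rat_adjoinI[OF h(1)])
qed

text \<open>Q[\<alpha>] is closed under all field operations; the algebraicity of \<alpha> enters
  only for inverses.\<close>

lemma generate_field_subset_rat_adjoin:
  assumes f: "minimal_int_poly \<alpha> f" and E: "E \<subseteq> rat_adjoin \<alpha>"
  shows "generate_field complex_ring E \<subseteq> rat_adjoin \<alpha>"
proof
  fix x assume "x \<in> generate_field complex_ring E"
  then show "x \<in> rat_adjoin \<alpha>"
  proof induction
    case one
    show ?case by (rule rat_adjoinI[of 1 _ _ 1]) auto
  next
    case (incl h)
    then show ?case using E by blast
  next
    case (a_inv h)
    then obtain g m where "m \<noteq> 0" "h = int_eval \<alpha> g / of_int m" by (elim rat_adjoinE)
    then show ?case by (intro rat_adjoinI[of m _ _ "- g"]) (auto simp: int_eval.hom_uminus)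
  next
    case (m_inv h)
    then obtain g m where gm: "m \<noteq> 0" "h = int_eval \<alpha> g / of_int m" by (elim rat_adjoinE)
    have h: "h \<noteq> 0" using m_inv.hyps by simp
    with gm have "int_eval \<alpha> g \<noteq> 0" by auto
    moreover have "inverse h * int_eval \<alpha> g = int_eval \<alpha> [:m:]"
      using h gm by simp
    ultimately show ?case
      unfolding complex_ring_m_inv[OF h] by (rule rat_adjoin_divide[OF f])
  next
    case (eng_add h1 h2)
    then obtain g1 m1 g2 m2 where "m1 \<noteq> 0" "h1 = int_eval \<alpha> g1 / of_int m1"
      "m2 \<noteq> 0" "h2 = int_eval \<alpha> g2 / of_int m2" by (elim rat_adjoinE)
    then show ?case
      by (intro rat_adjoinI[of "m1 * m2" _ _ "smult m2 g1 + smult m1 g2"])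
         (auto simp: int_eval.hom_add field_simps)
  next
    case (eng_mult h1 h2)
    then obtain g1 m1 g2 m2 where "m1 \<noteq> 0" "h1 = int_eval \<alpha> g1 / of_int m1"
      "m2 \<noteq> 0" "h2 = int_eval \<alpha> g2 / of_int m2" by (elim rat_adjoinE)
    then show ?case
      by (intro rat_adjoinI[of "m1 * m2" _ _ "g1 * g2"]) (auto simp: int_eval.hom_mult field_simps)
  qed
qed

lemma generate_field_complex:
  shows generate_field_complex_one: "1 \<in> generate_field complex_ring E"
    and generate_field_complex_uminus:
      "x \<in> generate_field complex_ring E \<Longrightarrow> - x \<in> generate_field complex_ring E"
    and generate_field_complex_inverse:
      "x \<in> generate_field complex_ring E \<Longrightarrow> x \<noteq> 0 \<Longrightarrow> inverse x \<in> generate_field complex_ring E"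
    and generate_field_complex_add:
      "x \<in> generate_field complex_ring E \<Longrightarrow> y \<in> generate_field complex_ring E \<Longrightarrow>
        x + y \<in> generate_field complex_ring E"
    and generate_field_complex_mult:
      "x \<in> generate_field complex_ring E \<Longrightarrow> y \<in> generate_field complex_ring E \<Longrightarrow>
        x * y \<in> generate_field complex_ring E"
  using generate_field.one[of complex_ring E] generate_field.a_inv[of x complex_ring E]
    generate_field.m_inv[of x complex_ring E] generate_field.eng_add[of x complex_ring E y]
    generate_field.eng_mult[of x complex_ring E y]
  by simp_all

lemma generate_field_complex_int: "of_int a \<in> generate_field complex_ring E"
proof (induction a rule: int_induct[where k = 1])
  case (step1 i)
  then show ?case
    using generate_field_complex_add generate_field_complex_one by fastforce
next
  case (step2 i)
  then show ?case
    using generate_field_complex_add[OF _ generate_field_complex_uminus[OF generate_field_complex_one]]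
    by fastforce
qed (use generate_field_complex_one in simp)

lemma generate_field_complex_sum:
  "(\<And>i. i \<in> I \<Longrightarrow> f i \<in> generate_field complex_ring E) \<Longrightarrow> sum f I \<in> generate_field complex_ring E"
proof (induction I rule: infinite_finite_induct)
  case (insert i I)
  then show ?case by (simp add: generate_field_complex_add)
qed (use generate_field_complex_int[of 0] in auto)

lemma rat_adjoin_subset_generate_field:
  assumes "\<alpha> \<in> generate_field complex_ring E"
  shows "rat_adjoin \<alpha> \<subseteq> generate_field complex_ring E"
proof
  fix x assume "x \<in> rat_adjoin \<alpha>"
  then obtain g m where gm: "m \<noteq> 0" "x = int_eval \<alpha> g / of_int m" by (elim rat_adjoinE)
  have "int_eval \<alpha> g \<in> generate_field complex_ring E"
    by (induction g) (use assms generate_field_complex_int generate_field_complex_int[of 0] in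
      \<open>auto intro: generate_field_complex_add generate_field_complex_mult\<close>)
  moreover have "inverse (of_int m) \<in> generate_field complex_ring E"
    using gm(1) generate_field_complex_int by (intro generate_field_complex_inverse) auto
  ultimately show "x \<in> generate_field complex_ring E"
    unfolding gm(2) divide_inverse by (rule generate_field_complex_mult)
qed

section \<open>Dimension over the rationals of a field generated by one element\<close>

text \<open>The rational span of the powers of \<alpha> with exponents below \<open>k\<close>.
  Bounding coefficients instead of requiring \<open>degree g < k\<close> yields the zero space for
  \<open>k = 0\<close>.\<close>

definition rat_span :: "complex \<Rightarrow> nat \<Rightarrow> complex set" where
  "rat_span \<alpha> k = {int_eval \<alpha> g / of_int m |g m. m \<noteq> 0 \<and> (\<forall>i\<ge>k. coeff g i = 0)}"

lemma rat_span_0: "rat_span \<alpha> 0 = {0}"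
proof -
  have "(\<forall>i\<ge>0. coeff g i = 0) \<longleftrightarrow> g = 0" for g :: "int poly"
    by (auto simp: poly_eq_iff)
  then show ?thesis by (auto simp: rat_span_def intro: exI[of _ 1])
qed

text \<open>Dimension is built up by adjoining one vector at a time; here that vector is
  \<open>\<alpha> ^ k\<close>, split off as the monomial of exponent \<open>k\<close>.\<close>

lemma line_extension_rat_span:
  "ring.line_extension complex_ring \<rat> (\<alpha> ^ k) (rat_span \<alpha> k) = rat_span \<alpha> (Suc k)"
proof -
  interpret cr: field complex_ring by (rule complex_ring_field)
  have "x \<in> rat_span \<alpha> (Suc k) \<longleftrightarrow> (\<exists>q\<in>\<rat>. \<exists>v\<in>rat_span \<alpha> k. x = q * \<alpha> ^ k + v)" for x
  proof
    assume "x \<in> rat_span \<alpha> (Suc k)"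
    then obtain g m where gm: "m \<noteq> 0" "x = int_eval \<alpha> g / of_int m" "\<forall>i\<ge>Suc k. coeff g i = 0"
      by (auto simp: rat_span_def)
    define h where "h = g - monom (coeff g k) k"
    have "coeff h i = 0" if "i \<ge> k" for i
      using gm(3) that by (cases "i = k") (auto simp: h_def)
    then have "int_eval \<alpha> h / of_int m \<in> rat_span \<alpha> k" using gm(1) unfolding rat_span_def by blast
    moreover have "x = of_int (coeff g k) / of_int m * \<alpha> ^ k + int_eval \<alpha> h / of_int m"
      using gm(1,2) by (simp add: h_def int_eval.hom_minus field_simps)
    moreover have "(of_int (coeff g k) / of_int m :: complex) \<in> \<rat>" by simp
    ultimately show "\<exists>q\<in>\<rat>. \<exists>v\<in>rat_span \<alpha> k. x = q * \<alpha> ^ k + v" by blast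
  next
    assume "\<exists>q\<in>\<rat>. \<exists>v\<in>rat_span \<alpha> k. x = q * \<alpha> ^ k + v"
    then obtain q v where qv: "q \<in> \<rat>" "v \<in> rat_span \<alpha> k" "x = q * \<alpha> ^ k + v" by blast
    obtain a b where ab: "b > 0" "q = of_int a / of_int b" using qv(1) by (elim Rats_cases')
    obtain g m where gm: "m \<noteq> 0" "v = int_eval \<alpha> g / of_int m" "\<forall>i\<ge>k. coeff g i = 0"
      using qv(2) by (auto simp: rat_span_def)
    have "x = int_eval \<alpha> (monom (a * m) k + smult b g) / of_int (b * m)"
      using ab gm qv(3) by (simp add: int_eval.hom_add field_simps)
    moreover have "\<forall>i\<ge>Suc k. coeff (monom (a * m) k + smult b g) i = 0" using gm(3) by auto
    moreover have "b * m \<noteq> 0" using ab gm by simp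
    ultimately show "x \<in> rat_span \<alpha> (Suc k)" unfolding rat_span_def by blast
  qed
  then show ?thesis by (auto simp: cr.line_extension_mem_iff)
qed

text \<open>A relation that expresses \<open>\<alpha> ^ k\<close> by lower powers would be a nonzero
  multiple of \<open>f\<close> of smaller degree.\<close>

lemma dimension_rat_span:
  assumes f: "minimal_int_poly \<alpha> f" and "k \<le> degree f"
  shows "ring.dimension complex_ring k \<rat> (rat_span \<alpha> k)"
  using assms(2)
proof (induction k)
  interpret cr: field complex_ring by (rule complex_ring_field)
  case 0
  show ?case using cr.zero_dim[of \<rat>] by (simp add: rat_span_0)
next
  interpret cr: field complex_ring by (rule complex_ring_field)
  case (Suc k)
  have "\<alpha> ^ k \<notin> rat_span \<alpha> k"
  proof
    assume "\<alpha> ^ k \<in> rat_span \<alpha> k"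
    then obtain g m where gm: "m \<noteq> 0" "\<alpha> ^ k = int_eval \<alpha> g / of_int m" "\<forall>i\<ge>k. coeff g i = 0"
      by (auto simp: rat_span_def)
    define h where "h = monom m k - g"
    have "int_eval \<alpha> h = 0" using gm(1,2) by (simp add: h_def int_eval.hom_minus)
    then have "f dvd h" using f by (simp add: minimal_int_poly_def)
    moreover have "coeff h k \<noteq> 0" using gm by (simp add: h_def)
    then have "h \<noteq> 0" by auto
    moreover have "degree h \<le> k"
      using gm(3) by (intro degree_le) (auto simp: h_def)
    ultimately show False using Suc.prems dvd_imp_degree_le[of f h] by simp
  qed
  then have "ring.dimension complex_ring (Suc k) \<rat> (cr.line_extension \<rat> (\<alpha> ^ k) (rat_span \<alpha> k))"
    using Suc by (intro cr.Suc_dim) auto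
  then show ?case by (simp only: line_extension_rat_span)
qed

lemma rat_span_degree:
  assumes f: "minimal_int_poly \<alpha> f"
  shows "rat_span \<alpha> (degree f) = rat_adjoin \<alpha>"
proof
  show "rat_span \<alpha> (degree f) \<subseteq> rat_adjoin \<alpha>" by (auto simp: rat_span_def rat_adjoin_def)
  show "rat_adjoin \<alpha> \<subseteq> rat_span \<alpha> (degree f)"
  proof
    fix x assume "x \<in> rat_adjoin \<alpha>"
    then obtain g m where gm: "m \<noteq> 0" "x = int_eval \<alpha> g / of_int m" by (elim rat_adjoinE)
    have f0: "f \<noteq> 0" and lc: "lead_coeff f = 1" and ev: "int_eval \<alpha> f = 0"
      using f by (auto simp: minimal_int_poly_def)
    obtain b where b: "g = f * b + pseudo_mod g f"
      using pseudo_divmod[OF f0, of g] lc unfolding pseudo_mod_def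
      by (metis prod.collapse power_one smult_1_left)
    have "int_eval \<alpha> g = int_eval \<alpha> (pseudo_mod g f)"
      using arg_cong[OF b, of "int_eval \<alpha>"] ev by (simp add: int_eval.hom_add int_eval.hom_mult)
    moreover have "\<forall>i\<ge>degree f. coeff (pseudo_mod g f) i = 0"
      using pseudo_mod(2)[OF f0, of g] by (auto intro: coeff_eq_0)
    ultimately show "x \<in> rat_span \<alpha> (degree f)"
      unfolding rat_span_def using gm by auto
  qed
qed

text \<open>The two hypotheses on \<open>E\<close> are the two inclusions between the generated
  field and Q[\<alpha>]: \<alpha> is a primitive element.\<close>

lemma dimension_generate_field:
  assumes "minimal_int_poly \<alpha> f" "E \<subseteq> rat_adjoin \<alpha>" "\<alpha> \<in> generate_field complex_ring E"
  shows "ring.dimension complex_ring (degree f) \<rat> (generate_field complex_ring E)"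
proof -
  have "generate_field complex_ring E = rat_span \<alpha> (degree f)"
    using generate_field_subset_rat_adjoin rat_adjoin_subset_generate_field rat_span_degree assms
    by blast
  then show ?thesis using dimension_rat_span[OF assms(1)] by simp
qed

section \<open>Eigenvalues of Cayley graphs over cyclic groups\<close>

text \<open>A geometric sum in \<open>q = z^a / z^b\<close>, an \<open>n\<close>-th root of unity
  that is 1 exactly for congruent exponents.\<close>

lemma root_of_unity_orthogonality:
  assumes z: "primitive_root n z"
  shows "(\<Sum>j<n. z ^ (a * j) * inverse z ^ (b * j)) = (if [a = b] (mod n) then of_nat n else 0)"
proof -
  have z0: "z \<noteq> 0" using primitive_root_nonzero[OF z] .
  define q where "q = z ^ a * inverse z ^ b"
  have eq: "(\<Sum>j<n. z ^ (a * j) * inverse z ^ (b * j)) = (\<Sum>j<n. q ^ j)"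
    by (simp add: q_def power_mult power_mult_distrib)
  have "q = 1 \<longleftrightarrow> z ^ a = z ^ b"
    using z0 by (simp add: q_def field_simps)
  then have q1: "q = 1 \<longleftrightarrow> [a = b] (mod n)"
    using primitive_root_power_eq_iff[OF z] by simp
  have zn: "z ^ n = 1" using z by (simp add: primitive_root_def)
  have "q ^ n = (z ^ n) ^ a * inverse ((z ^ n) ^ b)"
    by (simp add: q_def power_mult_distrib power_inverse flip: power_mult) (simp add: mult.commute)
  then have "q ^ n = 1" by (simp add: zn)
  show ?thesis
  proof (cases "q = 1")
    case True
    then show ?thesis unfolding eq using q1 by simp
  next
    case False
    then have "(\<Sum>j<n. q ^ j) = 0" using \<open>q ^ n = 1\<close> by (simp add: geometric_sum)
    then show ?thesis unfolding eq using q1 False by simp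
  qed
qed

text \<open>A Gaussian period for an arbitrary set; as a function of \<open>j\<close>, the discrete
  Fourier transform of the indicator function of \<open>S\<close>.\<close>

definition gauss_period :: "complex \<Rightarrow> int set \<Rightarrow> nat \<Rightarrow> complex" where
  "gauss_period z S j = (\<Sum>s\<in>S. z ^ (nat s * j))"

lemma nat_cong_iff:
  assumes "a \<in> {0..<int n}" "b \<in> {0..<int n}"
  shows "[nat a = nat b] (mod n) \<longleftrightarrow> a = b"
  using assms by (auto simp: cong_def nat_less_iff)

text \<open>Fourier inversion: swapping the sums and orthogonality recover the indicator function,
  up to the factor \<open>n\<close>.\<close>

lemma gauss_period_inversion:
  assumes z: "primitive_root n z" and S: "S \<subseteq> {0..<int n}" and m: "m \<in> {0..<int n}"
  shows "(\<Sum>j<n. gauss_period z S j * inverse z ^ (nat m * j)) = (if m \<in> S then of_nat n else 0)"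
proof -
  have fin: "finite S" using S finite_subset by blast
  have "(\<Sum>j<n. gauss_period z S j * inverse z ^ (nat m * j)) =
        (\<Sum>s\<in>S. \<Sum>j<n. z ^ (nat s * j) * inverse z ^ (nat m * j))"
    unfolding gauss_period_def sum_distrib_right by (rule sum.swap)
  also have "\<dots> = (\<Sum>s\<in>S. if s = m then of_nat n else 0)"
    using S m by (intro sum.cong) (auto simp: root_of_unity_orthogonality[OF z] nat_cong_iff)
  finally show ?thesis using fin by simp
qed

lemma gauss_period_eq_imp_eq:
  assumes z: "primitive_root n z" and S: "S \<subseteq> {0..<int n}" and T: "T \<subseteq> {0..<int n}"
    and eq: "\<And>j. j < n \<Longrightarrow> gauss_period z S j = gauss_period z T j"
  shows "S = T"
proof -
  have n: "n > 0" using z by (simp add: primitive_root_def)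
  have "m \<in> S \<longleftrightarrow> m \<in> T" if "m \<in> {0..<int n}" for m
    using gauss_period_inversion[OF z S that] gauss_period_inversion[OF z T that] eq n
    by (simp split: if_splits)
  then show ?thesis using S T by blast
qed

lemma power_nat_mod_int:
  assumes z: "primitive_root n z" and "a \<ge> 0"
  shows "z ^ nat (a mod int n) = z ^ nat a"
proof -
  have n: "n > 0" using z by (simp add: primitive_root_def)
  have "nat (a mod int n) = nat a mod n"
    using assms(2) n by (simp add: nat_mod_distrib)
  then show ?thesis by (simp add: primitive_root_power_eq_iff[OF z])
qed

text \<open>Multiplication by the unit \<open>t\<close> is injective on residues, so
  \<open>t\<close> can move from the index to the set. A conjugate of a period thus becomes a period
  of the scaled set.\<close>

lemma gauss_period_scale:
  assumes z: "primitive_root n z" and S: "S \<subseteq> {0..<int n}" and t: "coprime t n"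
  shows "gauss_period z S (t * j) = gauss_period z ((\<lambda>s. int t * s mod int n) ` S) j"
proof -
  have "inj_on (\<lambda>s. int t * s mod int n) S"
  proof (rule inj_onI)
    fix x y assume xy: "x \<in> S" "y \<in> S" "int t * x mod int n = int t * y mod int n"
    then have "[int t * x = int t * y] (mod int n)" by (simp add: cong_def)
    then have "[x = y] (mod int n)" using t by (subst (asm) cong_mult_lcancel) auto
    then show "x = y" using xy S by (auto simp: cong_def subset_iff)
  qed
  then have "gauss_period z ((\<lambda>s. int t * s mod int n) ` S) j = (\<Sum>s\<in>S. (z ^ nat (int t * s mod int n)) ^ j)"
    by (simp add: gauss_period_def sum.reindex power_mult)
  also have "\<dots> = gauss_period z S (t * j)"
    unfolding gauss_period_def
  proof (rule sum.cong)
    fix s assume "s \<in> S"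
    then have "s \<ge> 0" using S by auto
    then have "(z ^ nat (int t * s mod int n)) ^ j = (z ^ (t * nat s)) ^ j"
      by (simp add: power_nat_mod_int[OF z] nat_mult_distrib)
    also have "\<dots> = z ^ (nat s * (t * j))"
      unfolding power_mult[symmetric] by (simp add: ac_simps)
    finally show "(z ^ nat (int t * s mod int n)) ^ j = z ^ (nat s * (t * j))" .
  qed simp
  finally show ?thesis ..
qed

text \<open>An eigenvector is read as a function \<open>w\<close> on residues, on which the matrix
  acts by summing over the out-neighbours. This eliminates the enumeration
  \<open>vs\<close>.\<close>

lemma eigenvalue_adjacency_matrix:
  assumes n: "n > 0" and S: "S \<subseteq> {0..<int n}" and vs: "distinct vs" "set vs = {0..<int n}"
  shows "eigenvalue (adjacency_matrix (Cay (integer_mod_group n) S) vs) x \<longleftrightarrow>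
    (\<exists>w. (\<exists>a\<in>{0..<int n}. w a \<noteq> 0) \<and>
         (\<forall>a\<in>{0..<int n}. (\<Sum>s\<in>S. w ((a + s) mod int n)) = x * w a))"
proof -
  define A where "A = adjacency_matrix (Cay (integer_mod_group n) S) vs"
  have len: "length vs = n" using vs distinct_card[of vs] by simp
  have A: "A \<in> carrier_mat n n" by (simp add: A_def adjacency_matrix_def len)
  have bij: "bij_betw ((!) vs) {..<n} {0..<int n}"
    using vs len by (metis bij_betw_nth)
  have fin: "finite S" using S finite_subset by blast
  have arc: "(a, b) \<in> parcs (Cay (integer_mod_group n) S) \<longleftrightarrow> (b - a) mod int n \<in> S"
    if "a \<in> {0..<int n}" "b \<in> {0..<int n}" for a b
    using that n by (simp add: Cay_def carrier_integer_mod_group mod_simps)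
  have act: "vec_index (A *\<^sub>v v) i = (\<Sum>s\<in>S. w ((vs ! i + s) mod int n))"
    if v: "v \<in> carrier_vec n" and i: "i < n" and w: "\<And>k. k < n \<Longrightarrow> vec_index v k = w (vs ! k)" for v w i
  proof -
    have vi: "vs ! i \<in> {0..<int n}" using bij i by (auto simp: bij_betw_def)
    have "vec_index (A *\<^sub>v v) i = (\<Sum>k<n. A $$ (i, k) * vec_index v k)"
      using A v i by (simp add: scalar_prod_def atLeast0LessThan)
    also have "\<dots> = (\<Sum>k<n. if (vs ! k - vs ! i) mod int n \<in> S then w (vs ! k) else 0)"
    proof (rule sum.cong)
      fix k assume k: "k \<in> {..<n}"
      then have "vs ! k \<in> {0..<int n}" using bij by (auto simp: bij_betw_def)
      with vi k i show "A $$ (i, k) * vec_index v k =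
          (if (vs ! k - vs ! i) mod int n \<in> S then w (vs ! k) else 0)"
        by (simp add: A_def adjacency_matrix_def len w arc)
    qed simp
    also have "\<dots> = (\<Sum>b\<in>{0..<int n}. if (b - vs ! i) mod int n \<in> S then w b else 0)"
      by (rule sum.reindex_bij_betw[OF bij])
    also have "\<dots> = (\<Sum>b\<in>{b\<in>{0..<int n}. (b - vs ! i) mod int n \<in> S}. w b)"
      by (rule sum.inter_filter[symmetric]) simp
    also have "\<dots> = (\<Sum>s\<in>S. w ((vs ! i + s) mod int n))"
    proof (rule sum.reindex_bij_witness[of _ "\<lambda>s. (vs ! i + s) mod int n" "\<lambda>b. (b - vs ! i) mod int n"])
      fix s assume "s \<in> S"
      then have "s mod int n = s" using S by (auto simp: subset_iff)
      then show "((vs ! i + s) mod int n - vs ! i) mod int n = s"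
        "(vs ! i + s) mod int n \<in> {b \<in> {0..<int n}. (b - vs ! i) mod int n \<in> S}"
        using n \<open>s \<in> S\<close> by (auto simp: mod_simps)
    qed (auto simp: mod_simps)
    finally show ?thesis .
  qed
  show ?thesis
    unfolding A_def[symmetric]
  proof
    assume "eigenvalue A x"
    then obtain v where v: "v \<in> carrier_vec n" "v \<noteq> 0\<^sub>v n" "A *\<^sub>v v = x \<cdot>\<^sub>v v"
      using A by (auto simp: eigenvalue_def eigenvector_def)
    define w where "w = (\<lambda>a. vec_index v (inv_into {..<n} ((!) vs) a))"
    have w: "vec_index v k = w (vs ! k)" if "k < n" for k
      using bij that by (simp add: w_def bij_betw_def)
    obtain k where k: "k < n" "vec_index v k \<noteq> 0" using v(1,2) by (auto simp: vec_eq_iff)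
    have "\<exists>a\<in>{0..<int n}. w a \<noteq> 0"
      using k w bij by (intro bexI[of _ "vs ! k"]) (auto simp: bij_betw_def)
    moreover have "(\<Sum>s\<in>S. w ((a + s) mod int n)) = x * w a" if a: "a \<in> {0..<int n}" for a
    proof -
      have "a \<in> (!) vs ` {..<n}" using a bij by (simp add: bij_betw_def)
      then obtain i where i: "i < n" "a = vs ! i" by blast
      show ?thesis
        using act[OF v(1) i(1) w] v i w by simp
    qed
    ultimately show "\<exists>w. (\<exists>a\<in>{0..<int n}. w a \<noteq> 0) \<and>
         (\<forall>a\<in>{0..<int n}. (\<Sum>s\<in>S. w ((a + s) mod int n)) = x * w a)" by blast
  next
    assume "\<exists>w. (\<exists>a\<in>{0..<int n}. w a \<noteq> 0) \<and>
         (\<forall>a\<in>{0..<int n}. (\<Sum>s\<in>S. w ((a + s) mod int n)) = x * w a)"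
    then obtain w a where w: "a \<in> {0..<int n}" "w a \<noteq> 0"
      "\<And>a. a \<in> {0..<int n} \<Longrightarrow> (\<Sum>s\<in>S. w ((a + s) mod int n)) = x * w a" by blast
    define v where "v = vec n (\<lambda>k. w (vs ! k))"
    have v: "v \<in> carrier_vec n" by (simp add: v_def)
    have "a \<in> (!) vs ` {..<n}" using w(1) bij by (simp add: bij_betw_def)
    then obtain k where "k < n" "a = vs ! k" by blast
    then have "vec_index v k \<noteq> vec_index (0\<^sub>v n) k" using w(2) by (simp add: v_def)
    then have "v \<noteq> 0\<^sub>v n" by metis
    moreover have "A *\<^sub>v v = x \<cdot>\<^sub>v v"
    proof (rule eq_vecI)
      fix i assume "i < dim_vec (x \<cdot>\<^sub>v v)"
      then have i: "i < n" by (simp add: v_def)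
      then have "vs ! i \<in> {0..<int n}" using bij by (auto simp: bij_betw_def)
      then show "vec_index (A *\<^sub>v v) i = vec_index (x \<cdot>\<^sub>v v) i"
        using act[OF v i, of w] w(3) i by (simp add: v_def)
    qed (use A in \<open>simp add: v_def\<close>)
    ultimately show "eigenvalue A x"
      using A v by (auto simp: eigenvalue_def eigenvector_def)
  qed
qed

text \<open>The characters of the cyclic group are eigenvectors with the periods as eigenvalues.
  Conversely, every eigenvector has a nonzero Fourier coefficient, which forces its eigenvalue to be
  a period.\<close>

lemma graph_eigenvalues_Cay_integer_mod_group:
  assumes z: "primitive_root n z" and S: "S \<subseteq> {0..<int n}"
  shows "graph_eigenvalues (Cay (integer_mod_group n) S) = gauss_period z S ` {..<n}"
proof -
  have n: "n > 0" using z by (simp add: primitive_root_def)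
  have z0: "z \<noteq> 0" using primitive_root_nonzero[OF z] .
  have fin: "finite S" using S finite_subset by blast
  have shift: "z ^ (nat ((a + s) mod int n) * j) = z ^ (nat a * j) * z ^ (nat s * j)"
    if "a \<in> {0..<int n}" "s \<in> S" for a s j
  proof -
    have "z ^ nat ((a + s) mod int n) = z ^ nat a * z ^ nat s"
      using that S by (subst power_nat_mod_int[OF z]) (auto simp: nat_add_distrib power_add subset_iff)
    then show ?thesis by (simp add: power_mult power_mult_distrib)
  qed
  have "(\<exists>w. (\<exists>a\<in>{0..<int n}. w a \<noteq> 0) \<and>
         (\<forall>a\<in>{0..<int n}. (\<Sum>s\<in>S. w ((a + s) mod int n)) = x * w a)) \<longleftrightarrow> x \<in> gauss_period z S ` {..<n}" for x
  proof
    assume "\<exists>w. (\<exists>a\<in>{0..<int n}. w a \<noteq> 0) \<and>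
         (\<forall>a\<in>{0..<int n}. (\<Sum>s\<in>S. w ((a + s) mod int n)) = x * w a)"
    then obtain w c where c: "c \<in> {0..<int n}" "w c \<noteq> 0"
      and w: "\<And>a. a \<in> {0..<int n} \<Longrightarrow> (\<Sum>s\<in>S. w ((a + s) mod int n)) = x * w a" by blast
    \<comment> \<open>Fourier coefficients of \<open>w\<close>; inversion at \<open>c\<close> shows
      that they are not all zero.\<close>
    define W where "W = (\<lambda>j. \<Sum>a\<in>{0..<int n}. w a * inverse z ^ (nat a * j))"
    have "(\<Sum>j<n. W j * z ^ (nat c * j)) =
        (\<Sum>a\<in>{0..<int n}. \<Sum>j<n. w a * (z ^ (nat c * j) * inverse z ^ (nat a * j)))"
      unfolding W_def sum_distrib_right by (subst sum.swap) (simp only: mult_ac)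
    also have "\<dots> = (\<Sum>a\<in>{0..<int n}. if a = c then of_nat n * w c else 0)"
    proof (rule sum.cong)
      fix a assume a: "a \<in> {0..<int n}"
      show "(\<Sum>j<n. w a * (z ^ (nat c * j) * inverse z ^ (nat a * j))) =
          (if a = c then of_nat n * w c else 0)"
        unfolding sum_distrib_left[symmetric] root_of_unity_orthogonality[OF z] nat_cong_iff[OF c(1) a]
        by simp
    qed simp
    also have "\<dots> \<noteq> 0" using c n by simp
    finally have "(\<Sum>j<n. W j * z ^ (nat c * j)) \<noteq> 0" .
    then obtain j where j: "j < n" "W j \<noteq> 0"
      by (metis (mono_tags, lifting) lessThan_iff mult_eq_0_iff sum.not_neutral_contains_not_neutral)
    have "x * W j = (\<Sum>a\<in>{0..<int n}. \<Sum>s\<in>S. w ((a + s) mod int n) * inverse z ^ (nat a * j))"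
      unfolding W_def sum_distrib_left
    proof (rule sum.cong)
      fix a assume a: "a \<in> {0..<int n}"
      show "x * (w a * inverse z ^ (nat a * j)) =
          (\<Sum>s\<in>S. w ((a + s) mod int n) * inverse z ^ (nat a * j))"
        unfolding sum_distrib_right[symmetric] w[OF a] by (rule mult.assoc[symmetric])
    qed simp
    also have "\<dots> = (\<Sum>s\<in>S. \<Sum>a\<in>{0..<int n}. w ((a + s) mod int n) * inverse z ^ (nat a * j))"
      by (rule sum.swap)
    \<comment> \<open>Translating \<open>w\<close> by \<open>s\<close> multiplies its
      \<open>j\<close>-th Fourier coefficient by \<open>z ^ (nat s * j)\<close>.\<close>
    also have "\<dots> = (\<Sum>s\<in>S. z ^ (nat s * j) * W j)"
    proof (rule sum.cong)
      fix s assume s: "s \<in> S"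
      have "(\<Sum>a\<in>{0..<int n}. w ((a + s) mod int n) * inverse z ^ (nat a * j)) =
          (\<Sum>a\<in>{0..<int n}. z ^ (nat s * j) * (w ((a + s) mod int n) * inverse z ^ (nat ((a + s) mod int n) * j)))"
      proof (rule sum.cong)
        fix a assume "a \<in> {0..<int n}"
        from shift[OF this s, of j] z0
        have "inverse z ^ (nat a * j) = z ^ (nat s * j) * inverse z ^ (nat ((a + s) mod int n) * j)"
          unfolding power_inverse by simp
        then show "w ((a + s) mod int n) * inverse z ^ (nat a * j) =
            z ^ (nat s * j) * (w ((a + s) mod int n) * inverse z ^ (nat ((a + s) mod int n) * j))"
          by simp
      qed simp
      also have "\<dots> = (\<Sum>b\<in>{0..<int n}. z ^ (nat s * j) * (w b * inverse z ^ (nat b * j)))"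
        using n by (intro sum.reindex_bij_witness[of _ "\<lambda>b. (b - s) mod int n" "\<lambda>a. (a + s) mod int n"])
          (auto simp: mod_simps)
      finally show "(\<Sum>a\<in>{0..<int n}. w ((a + s) mod int n) * inverse z ^ (nat a * j)) = z ^ (nat s * j) * W j"
        by (simp add: W_def sum_distrib_left)
    qed simp
    also have "\<dots> = gauss_period z S j * W j" by (simp add: gauss_period_def sum_distrib_right)
    finally show "x \<in> gauss_period z S ` {..<n}" using j by auto
  next
    assume "x \<in> gauss_period z S ` {..<n}"
    then obtain j where x: "x = gauss_period z S j" by blast
    have "(\<Sum>s\<in>S. z ^ (nat ((a + s) mod int n) * j)) = x * z ^ (nat a * j)" if "a \<in> {0..<int n}" for a
      unfolding x gauss_period_def sum_distrib_right
    proof (rule sum.cong)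
      fix s assume "s \<in> S"
      show "z ^ (nat ((a + s) mod int n) * j) = z ^ (nat s * j) * z ^ (nat a * j)"
        unfolding shift[OF that \<open>s \<in> S\<close>] by (rule mult.commute)
    qed simp
    then show "\<exists>w. (\<exists>a\<in>{0..<int n}. w a \<noteq> 0) \<and>
         (\<forall>a\<in>{0..<int n}. (\<Sum>s\<in>S. w ((a + s) mod int n)) = x * w a)"
      using z0 n by (intro exI[of _ "\<lambda>a. z ^ (nat a * j)"]) auto
  qed
  then have ev: "eigenvalue (adjacency_matrix (Cay (integer_mod_group n) S) vs) x \<longleftrightarrow> x \<in> gauss_period z S ` {..<n}"
    if "distinct vs" "set vs = {0..<int n}" for vs x
    using eigenvalue_adjacency_matrix[OF n S that] by simp
  have "pverts (Cay (integer_mod_group n) S) = {0..<int n}"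
    using n by (simp add: Cay_def carrier_integer_mod_group)
  moreover have "\<exists>vs. distinct vs \<and> set vs = {0..<int n}"
    by (rule exI[of _ "[0..int n - 1]"]) auto
  ultimately show ?thesis
    using ev unfolding graph_eigenvalues_def by (intro equalityI subsetI; simp) blast+
qed

section \<open>The degree of the splitting field\<close>

text \<open>Sending \<open>f u\<close> to \<open>g u\<close> is a bijection of the images. It will
  match the conjugates of a primitive element with the scaled connection sets.\<close>

lemma card_image_same_kernel:
  assumes "\<And>s t. s \<in> U \<Longrightarrow> t \<in> U \<Longrightarrow> f s = f t \<longleftrightarrow> g s = g t"
  shows "card (f ` U) = card (g ` U)"
proof -
  define h where "h = (\<lambda>y. g (inv_into U f y))"
  have h: "h (f u) = g u" if "u \<in> U" for u
    using assms[of "inv_into U f (f u)" u] that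
    by (simp add: h_def inv_into_into f_inv_into_f)
  have "inj_on h (f ` U)"
    using assms h by (auto simp: inj_on_def)
  moreover have "h ` f ` U = g ` U"
    using h by (auto simp: image_iff)
  ultimately show ?thesis by (metis card_image)
qed

definition unit_orbit :: "nat \<Rightarrow> int set \<Rightarrow> int set set" where
  "unit_orbit n S = {(\<lambda>s. int t * s mod int n) ` S |t. coprime t n}"

text \<open>Finitely many nonzero polynomials have finitely many roots, so some natural number
  avoids them all. It supplies the generic coefficients of the primitive element.\<close>

lemma separating_nat:
  fixes P :: "'i \<Rightarrow> complex poly"
  assumes "finite I"
  obtains c :: nat where "\<And>i. i \<in> I \<Longrightarrow> poly (P i) (of_nat c) = 0 \<Longrightarrow> P i = 0"
proof -
  have "finite (\<Union>i\<in>{i \<in> I. P i \<noteq> 0}. {x. poly (P i) x = 0})"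
    using assms by (auto intro: poly_roots_finite)
  moreover have "infinite (range (of_nat :: nat \<Rightarrow> complex))"
    by (simp add: finite_image_iff)
  ultimately obtain c :: nat where "of_nat c \<notin> (\<Union>i\<in>{i \<in> I. P i \<noteq> 0}. {x. poly (P i) x = 0})"
    by (metis (no_types, lifting) finite_subset image_subset_iff)
  then show ?thesis using that[of c] by auto
qed

text \<open>Valid for every connection set: the conjugates of a generic combination of eigenvalues
  are told apart exactly by the scaled sets, so the orbit size is its degree.\<close>

theorem k_integral_Cay_integer_mod_group:
  assumes n: "n > 0" and S: "S \<subseteq> {0..<int n}"
  shows "k_integral (card (unit_orbit n S)) (Cay (integer_mod_group n) S)"
proof -
  define z where "z = cis (2 * pi / real n)"
  have z: "primitive_root n z"
    unfolding primitive_root_def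
  proof (intro conjI allI)
    fix k
    have "cis x = 1 \<longleftrightarrow> cos x = 1" for x
      using cos_one_sin_zero[of x] by (auto simp: complex_eq_iff)
    then have "z ^ k = 1 \<longleftrightarrow> (\<exists>i::int. real k * (2 * pi / real n) = of_int i * 2 * pi)"
      by (simp add: z_def DeMoivre cos_one_2pi_int)
    also have "\<dots> \<longleftrightarrow> (\<exists>i::int. int k = i * int n)"
    proof (intro ex_cong1)
      fix i :: int
      have "real k * (2 * pi / real n) = of_int i * 2 * pi \<longleftrightarrow> real k = of_int i * real n"
        using n by (simp add: field_simps)
      also have "\<dots> \<longleftrightarrow> int k = i * int n"
        by (metis of_int_eq_iff of_int_mult of_int_of_nat_eq)
      finally show "real k * (2 * pi / real n) = of_int i * 2 * pi \<longleftrightarrow> int k = i * int n" .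
    qed
    also have "\<dots> \<longleftrightarrow> n dvd k"
      by (metis dvd_def int_dvd_int_iff mult.commute)
    finally show "z ^ k = 1 \<longleftrightarrow> n dvd k" .
  qed (rule n)
  have fin: "finite S" using S finite_subset by blast
  have gauss_period_mod: "gauss_period z S ((t mod n) * j) = gauss_period z S (t * j)" for t j
    unfolding gauss_period_def
    by (intro sum.cong iffD2[OF primitive_root_power_eq_iff[OF z]] cong_mult cong_refl)
       (simp_all add: cong_def)
  define B where "B = (\<lambda>j. \<Sum>s\<in>S. monom (1::int) (nat s * j))"
  have B: "int_eval (z ^ t) (B j) = gauss_period z S (t * j)" for t j
    by (simp add: B_def int_eval.hom_sum gauss_period_def mult_ac flip: power_mult)
  \<comment> \<open>The differences of the periods for \<open>s\<close> and \<open>t\<close> become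
    the coefficients of one polynomial, whose value at \<open>c\<close> is the difference of two
    conjugates of \<open>A(z)\<close>. Exponents below \<open>n\<close> suffice, as periods depend
    on them modulo \<open>n\<close>.\<close>
  define P where "P = (\<lambda>(s, t). \<Sum>j<n. monom (gauss_period z S (s * j) - gauss_period z S (t * j)) j)"
  obtain c :: nat where c: "\<And>i. i \<in> {..<n} \<times> {..<n} \<Longrightarrow> poly (P i) (of_nat c) = 0 \<Longrightarrow> P i = 0"
    using separating_nat[of "{..<n} \<times> {..<n}" P] by auto
  define A where "A = (\<Sum>j<n. smult (int c ^ j) (B j))"
  have A: "int_eval (z ^ t) A = (\<Sum>j<n. gauss_period z S (t * j) * of_nat c ^ j)" for t
    by (simp add: A_def int_eval.hom_sum B mult.commute[of "of_nat c ^ j" for j])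
  have A_imp: "gauss_period z S (s * j) = gauss_period z S (t * j)"
    if eq: "int_eval (z ^ s) A = int_eval (z ^ t) A" and j: "j < n" for s t j
  proof -
    let ?i = "(s mod n, t mod n)"
    have "poly (P ?i) (of_nat c) = int_eval (z ^ s) A - int_eval (z ^ t) A"
      by (simp add: P_def A poly_sum poly_monom gauss_period_mod left_diff_distrib sum_subtractf)
    then have "P ?i = 0" using eq c[of ?i] n by simp
    then have "coeff (P ?i) j = 0" by simp
    then show ?thesis using j by (simp add: P_def coeff_sum gauss_period_mod)
  qed
  \<comment> \<open>Equal conjugates have equal periods by the choice of \<open>c\<close>, and then
    equal scaled sets by Fourier inversion.\<close>
  have A_iff: "int_eval (z ^ s) A = int_eval (z ^ t) A \<longleftrightarrow>
      (\<lambda>x. int s * x mod int n) ` S = (\<lambda>x. int t * x mod int n) ` S"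
    if st: "coprime s n" "coprime t n" for s t
  proof
    assume "int_eval (z ^ s) A = int_eval (z ^ t) A"
    from A_imp[OF this] show "(\<lambda>x. int s * x mod int n) ` S = (\<lambda>x. int t * x mod int n) ` S"
      by (intro gauss_period_eq_imp_eq[OF z]) (use n st in \<open>auto simp: gauss_period_scale[OF z S]\<close>)
  next
    assume "(\<lambda>x. int s * x mod int n) ` S = (\<lambda>x. int t * x mod int n) ` S"
    then show "int_eval (z ^ s) A = int_eval (z ^ t) A"
      using st by (simp add: A gauss_period_scale[OF z S])
  qed
  define \<alpha> where "\<alpha> = int_eval z A"
  obtain f where f: "minimal_int_poly \<alpha> f" and deg: "degree f = card (conjugates n z A)"
    using minimal_int_poly_conjugates[OF z] unfolding \<alpha>_def by blast
  have ev: "graph_eigenvalues (Cay (integer_mod_group n) S) = gauss_period z S ` {..<n}"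
    by (rule graph_eigenvalues_Cay_integer_mod_group[OF z S])
  have "ring.dimension complex_ring (degree f) \<rat> (generate_field complex_ring (gauss_period z S ` {..<n}))"
  proof (rule dimension_generate_field[OF f])
    show "gauss_period z S ` {..<n} \<subseteq> rat_adjoin \<alpha>"
    proof
      fix x assume "x \<in> gauss_period z S ` {..<n}"
      then obtain j where j: "j < n" "x = gauss_period z S j" by blast
      obtain N D where "int_eval \<alpha> D \<noteq> 0" "int_eval z (B j) * int_eval \<alpha> D = int_eval \<alpha> N"
        using primitive_element[OF z, of A "B j"] A_imp j(1) unfolding \<alpha>_def B by metis
      moreover have "int_eval z (B j) = x" using B[of 1 j] j by simp
      ultimately show "x \<in> rat_adjoin \<alpha>" using rat_adjoin_divide[OF f] by blast
    qed
    have "\<alpha> = (\<Sum>j<n. of_int (int c ^ j) * gauss_period z S j)"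
      using A[of 1] by (simp add: \<alpha>_def mult.commute)
    moreover have "\<dots> \<in> generate_field complex_ring (gauss_period z S ` {..<n})"
      by (intro generate_field_complex_sum generate_field_complex_mult generate_field_complex_int
          generate_field.incl) auto
    ultimately show "\<alpha> \<in> generate_field complex_ring (gauss_period z S ` {..<n})" by simp
  qed
  moreover have "card (conjugates n z A) = card (unit_orbit n S)"
    unfolding conjugates_def unit_orbit_def setcompr_eq_image
    by (rule card_image_same_kernel) (use A_iff in auto)
  ultimately show ?thesis
    by (simp add: k_integral_def splitting_field_def ev deg)
qed

section \<open>Subgroups of prime index\<close>

text \<open>A maximal proper subgroup \<open>H\<close> containing \<open>K\<close> has index \<open>p\<close>: some \<open>y \<notin> H\<close> has
  \<open>y\<^sup>p \<in> H\<close>, and by maximality the powers of \<open>y\<close> represent all cosets of \<open>H\<close>.\<close>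

lemma (in comm_group) exists_subgroup_prime_index:
  assumes fin: "finite (carrier G)" and K: "subgroup K G" "K \<noteq> carrier G" and p: "prime p"
    and pow: "\<And>x. x \<in> carrier G \<Longrightarrow> \<exists>k. x [^] (p ^ k) \<in> K"
  obtains H where "subgroup H G" "K \<subseteq> H" "p * card H = card (carrier G)"
proof -
  let ?A = "{H. subgroup H G \<and> K \<subseteq> H \<and> H \<noteq> carrier G}"
  have "?A \<subseteq> Pow (carrier G)" by (auto dest: subgroup.subset)
  then have "finite ?A" using fin finite_subset by blast
  moreover have "K \<in> ?A" using K by simp
  ultimately have "\<exists>H\<in>?A. K \<subseteq> H \<and> (\<forall>L\<in>?A. H \<subseteq> L \<longrightarrow> H = L)"
    by (rule finite_has_maximal2)
  then obtain H where H_max: "H \<in> ?A" "\<forall>L\<in>?A. H \<subseteq> L \<longrightarrow> H = L" by (elim bexE conjE)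
  then have H: "subgroup H G" "K \<subseteq> H" "H \<noteq> carrier G" by simp_all
  have max: "L = carrier G" if "subgroup L G" "H \<subset> L" for L
  proof (rule ccontr)
    assume "L \<noteq> carrier G"
    with that H(2) have "L \<in> ?A" by auto
    with H_max(2) that(2) show False by blast
  qed
  interpret H: subgroup H G by (rule H(1))
  obtain x where x: "x \<in> carrier G" "x \<notin> H" using H(3) H.subset by blast
  have "\<exists>k. x [^] (p ^ k) \<in> H" using pow[OF x(1)] H(2) by blast
  then obtain k where xk: "x [^] (p ^ k) \<in> H" and k_min: "\<And>j. j < k \<Longrightarrow> x [^] (p ^ j) \<notin> H"
    by (subst (asm) exists_least_iff) blast
  have k0: "k \<noteq> 0" using xk x by (intro notI) simp
  \<comment> \<open>By minimality of \<open>k \<noteq> 0\<close>, this element is outside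
    \<open>H\<close> while its \<open>p\<close>-th power is inside.\<close>
  define y where "y = x [^] (p ^ (k - 1))"
  have yc: "y \<in> carrier G" using x by (simp add: y_def)
  have yH: "y \<notin> H"
    unfolding y_def using k0 by (intro k_min) simp
  have "y [^] p = x [^] (p ^ k)"
    unfolding y_def nat_pow_pow[OF x(1)] using power_minus_mult[of k p] k0 by simp
  then have "y [^] int p \<in> H" using xk by (simp add: int_pow_int)
  then have y_mult: "y [^] (int p * q) \<in> H" for q
    using subgroup_int_pow_closed[OF H(1)] yc by (simp flip: int_pow_pow)
  \<comment> \<open>If \<open>p\<close> does not divide \<open>i\<close>, a Bezout identity for
    \<open>p\<close> and \<open>i\<close> would put \<open>y\<close> itself into
    \<open>H\<close>.\<close>
  have y_iff: "y [^] i \<in> H \<longleftrightarrow> int p dvd i" for i :: int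
  proof
    assume i: "y [^] i \<in> H"
    show "int p dvd i"
    proof (rule ccontr)
      assume "\<not> int p dvd i"
      then have "coprime (int p) i" using p prime_imp_coprime[of "int p" i] by simp
      moreover obtain a b where "a * int p + b * i = gcd (int p) i" using bezout_int by blast
      ultimately have "int p * a + i * b = 1" by (simp add: mult.commute)
      moreover have "y [^] (int p * a + i * b) \<in> H"
        using y_mult[of a] subgroup_int_pow_closed[OF H(1) i, of b] yc
        by (simp add: int_pow_mult int_pow_pow)
      ultimately show False using yH yc by simp
    qed
  next
    assume "int p dvd i"
    then obtain q where "i = int p * q" by (rule dvdE)
    then show "y [^] i \<in> H" using y_mult by simp
  qed
  \<comment> \<open>The subgroup generated by \<open>H\<close> and \<open>y\<close>; it is strictly
    larger than \<open>H\<close>, hence everything.\<close>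
  define L where "L = {h \<otimes> y [^] i |h i::int. h \<in> H}"
  have "subgroup L G"
  proof (rule subgroupI)
    show "L \<subseteq> carrier G" using yc by (auto simp: L_def)
    have "\<one> \<otimes> y [^] (0::int) \<in> L" unfolding L_def using H.one_closed by blast
    then show "L \<noteq> {}" by blast
  next
    fix a assume "a \<in> L"
    then obtain h i where a: "a = h \<otimes> y [^] (i::int)" "h \<in> H" by (auto simp: L_def)
    then have "inv a = inv h \<otimes> y [^] (- i)"
      using yc by (simp add: inv_mult int_pow_neg)
    then show "inv a \<in> L" using a(2) by (auto simp: L_def)
  next
    fix a b assume "a \<in> L" "b \<in> L"
    then obtain h i h' j where a: "a = h \<otimes> y [^] (i::int)" "h \<in> H"
      and b: "b = h' \<otimes> y [^] (j::int)" "h' \<in> H" by (auto simp: L_def)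
    then have "a \<otimes> b = (h \<otimes> h') \<otimes> y [^] (i + j)"
      using yc by (simp add: int_pow_mult m_ac)
    then show "a \<otimes> b \<in> L" using a(2) b(2) by (auto simp: L_def)
  qed
  moreover have "H \<subset> L"
  proof
    show "H \<subseteq> L"
    proof
      fix h assume "h \<in> H"
      then have "h = h \<otimes> y [^] (0::int)" by simp
      then show "h \<in> L" using \<open>h \<in> H\<close> unfolding L_def by blast
    qed
    have "y = \<one> \<otimes> y [^] (1::int)" using yc by simp
    then have "y \<in> L" unfolding L_def using H.one_closed by blast
    then show "H \<noteq> L" using yH by blast
  qed
  ultimately have L: "L = carrier G" by (rule max)
  have "rcosets H = (\<lambda>i. H #> y [^] i) ` {0..<int p}"
  proof
    show "(\<lambda>i. H #> y [^] i) ` {0..<int p} \<subseteq> rcosets H"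
      using yc by (auto simp: RCOSETS_def)
    show "rcosets H \<subseteq> (\<lambda>i. H #> y [^] i) ` {0..<int p}"
    proof
      fix C assume "C \<in> rcosets H"
      then obtain g where g: "g \<in> carrier G" "C = H #> g" by (auto simp: RCOSETS_def)
      have "g \<in> L" using g(1) L by simp
      then obtain h i where hi: "g = h \<otimes> y [^] (i::int)" "h \<in> H" unfolding L_def by blast
      have "y [^] i = y [^] (int p * (i div int p) + i mod int p)" by simp
      also have "\<dots> = y [^] (int p * (i div int p)) \<otimes> y [^] (i mod int p)"
        using yc by (rule int_pow_mult)
      finally have "g = (h \<otimes> y [^] (int p * (i div int p))) \<otimes> y [^] (i mod int p)"
        using hi yc by (simp add: m_assoc)
      then have "g \<in> H #> y [^] (i mod int p)"
        using H.m_closed[OF hi(2) y_mult] unfolding r_coset_def by blast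
      then have "C = H #> y [^] (i mod int p)"
        unfolding g(2) using repr_independence[OF _ _ H(1)] yc by simp
      then show "C \<in> (\<lambda>i. H #> y [^] i) ` {0..<int p}"
        using prime_gt_0_nat[OF p] by auto
    qed
  qed
  moreover have "inj_on (\<lambda>i. H #> y [^] i) {0..<int p}"
  proof (rule inj_onI)
    fix i j assume ij: "i \<in> {0..<int p}" "j \<in> {0..<int p}" "H #> y [^] i = H #> y [^] j"
    then have "y [^] i \<in> H #> y [^] j" using rcos_self[OF _ H(1)] yc by blast
    then obtain h where h: "h \<in> H" "y [^] i = h \<otimes> y [^] j" by (auto simp: r_coset_def)
    then have "h = y [^] (i - j)"
      using yc H.mem_carrier[OF h(1)] by (simp add: int_pow_diff h(2) m_assoc)
    then have "int p dvd i - j" using h(1) y_iff by simp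
    then show "i = j" using ij(1,2) by (simp flip: mod_eq_dvd_iff)
  qed
  ultimately have "card (rcosets H) = p" by (simp add: card_image)
  then have "p * card H = card (carrier G)" using lagrange[OF H(1)] by (simp add: Coset.order_def)
  then show ?thesis using that H by blast
qed

text \<open>The kernel of the \<open>p\<close>-th power map contains an element of order
  \<open>p\<close>. The map is therefore not injective, and on a finite set not surjective.\<close>

lemma (in comm_group) power_image_proper:
  assumes fin: "finite (carrier G)" and p: "prime p" "p dvd card (carrier G)"
  shows "subgroup ((\<lambda>x. x [^] p) ` carrier G) G" "(\<lambda>x. x [^] p) ` carrier G \<noteq> carrier G"
proof -
  let ?f = "\<lambda>x. x [^] p"
  show "subgroup (?f ` carrier G) G"
  proof (rule subgroupI)
    fix a assume "a \<in> ?f ` carrier G"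
    then obtain x where "x \<in> carrier G" "a = x [^] p" by blast
    then show "inv a \<in> ?f ` carrier G"
      by (intro image_eqI[of _ _ "inv x"]) (auto simp: nat_pow_inv)
  next
    fix a b assume "a \<in> ?f ` carrier G" "b \<in> ?f ` carrier G"
    then obtain x y where "x \<in> carrier G" "a = x [^] p" "y \<in> carrier G" "b = y [^] p" by blast
    then show "a \<otimes> b \<in> ?f ` carrier G"
      by (intro image_eqI[of _ _ "x \<otimes> y"]) (auto simp: pow_mult_distrib m_comm)
  qed auto
  \<comment> \<open>With exponent 1, Sylow's theorem yields a subgroup of order
    \<open>p\<close>.\<close>
  obtain m where "card (carrier G) = p ^ 1 * m" using p(2) by auto
  then have "Coset.order G = p ^ 1 * m" by (simp add: Coset.order_def)
  from sylow_thm[OF p(1) is_group this fin] obtain P where P: "subgroup P G" "card P = p" by auto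
  interpret P: subgroup P G by (rule P(1))
  have "P \<noteq> {\<one>}" using P(2) prime_gt_1_nat[OF p(1)] by auto
  then obtain x where x: "x \<in> P" "x \<noteq> \<one>" using P.one_closed by blast
  interpret PG: group "G\<lparr>carrier := P\<rparr>" by (rule subgroup_imp_group[OF P(1)])
  have "x [^]\<^bsub>G\<lparr>carrier := P\<rparr>\<^esub> Coset.order (G\<lparr>carrier := P\<rparr>) = \<one>\<^bsub>G\<lparr>carrier := P\<rparr>\<^esub>"
    using x(1) by (intro PG.pow_order_eq_1) simp
  then have "x [^] p = \<one>"
    using P(2) by (simp add: Coset.order_def nat_pow_consistent[symmetric])
  moreover have "x \<in> carrier G" using x(1) by simp
  ultimately have "\<not> inj_on ?f (carrier G)"
    using x(2) one_closed nat_pow_one unfolding inj_on_def by metis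
  then show "?f ` carrier G \<noteq> carrier G"
    using fin finite_surj_inj[of "carrier G" ?f] by auto
qed

section \<open>The unit group of the residues modulo n\<close>

lemma unit_group:
  assumes "n > 1"
  shows comm_group_unit_group: "comm_group (units_of (residue_ring (int n)))"
    and carrier_unit_group:
      "carrier (units_of (residue_ring (int n))) = {x. 0 < x \<and> x < int n \<and> coprime x (int n)}"
    and card_unit_group: "card (carrier (units_of (residue_ring (int n)))) = totient n"
    and mult_unit_group: "x \<otimes>\<^bsub>units_of (residue_ring (int n))\<^esub> y = x * y mod int n"
    and one_unit_group: "\<one>\<^bsub>units_of (residue_ring (int n))\<^esub> = 1"
proof -
  interpret residues "int n" "residue_ring (int n)"
    by unfold_locales (use assms in auto)
  show "comm_group (units_of (residue_ring (int n)))" by (rule units_comm_group)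
  show "carrier (units_of (residue_ring (int n))) = {x. 0 < x \<and> x < int n \<and> coprime x (int n)}"
    by (simp add: units_of_carrier res_units_eq)
  show "card (carrier (units_of (residue_ring (int n)))) = totient n"
    using totient_eq by (simp add: units_of_carrier)
  show "x \<otimes>\<^bsub>units_of (residue_ring (int n))\<^esub> y = x * y mod int n"
    by (simp add: units_of_mult res_mult_eq)
  show "\<one>\<^bsub>units_of (residue_ring (int n))\<^esub> = 1"
    by (simp add: units_of_one res_one_eq)
qed

lemma mod_in_unit_group:
  assumes "n > 1" "coprime a (int n)"
  shows "a mod int n \<in> carrier (units_of (residue_ring (int n)))"
proof -
  interpret residues "int n" "residue_ring (int n)"
    by unfold_locales (use assms in auto)
  show ?thesis using mod_in_res_units[of a] assms by (simp add: units_of_carrier)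
qed

lemma pow_unit_group:
  assumes "n > 1" "x \<in> carrier (units_of (residue_ring (int n)))"
  shows "x [^]\<^bsub>units_of (residue_ring (int n))\<^esub> (k::nat) = x ^ k mod int n"
proof -
  interpret U: comm_group "units_of (residue_ring (int n))" by (rule comm_group_unit_group[OF assms(1)])
  show ?thesis
    by (induction k) (use assms in \<open>simp_all add: mult_unit_group one_unit_group mod_simps mult.commute\<close>)
qed

text \<open>The scaled sets of a subgroup are its cosets, which Lagrange's theorem counts.\<close>

lemma card_unit_orbit_subgroup:
  assumes n: "n > 1" and H: "subgroup H (units_of (residue_ring (int n)))"
  shows "card (unit_orbit n H) * card H = totient n"
proof -
  let ?U = "units_of (residue_ring (int n))"
  interpret U: comm_group ?U by (rule comm_group_unit_group[OF n])
  have coset: "H #>\<^bsub>?U\<^esub> a = (\<lambda>s. a * s mod int n) ` H" for a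
    using n by (auto simp: r_coset_def mult_unit_group mult.commute)
  have mod_eq: "(\<lambda>s. (a mod int n) * s mod int n) ` H = (\<lambda>s. a * s mod int n) ` H" for a
    by (simp add: mod_simps)
  have "unit_orbit n H = rcosets\<^bsub>?U\<^esub> H"
  proof (intro equalityI subsetI)
    fix C assume "C \<in> unit_orbit n H"
    then obtain t where t: "coprime t n" "C = (\<lambda>s. int t * s mod int n) ` H"
      unfolding unit_orbit_def by blast
    have "int t mod int n \<in> carrier ?U" using t(1) by (intro mod_in_unit_group[OF n]) simp
    moreover have "C = H #>\<^bsub>?U\<^esub> (int t mod int n)"
      unfolding t(2) coset mod_eq ..
    ultimately show "C \<in> rcosets\<^bsub>?U\<^esub> H"
      using U.rcosetsI[OF subgroup.subset[OF H]] by simp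
  next
    fix C assume "C \<in> rcosets\<^bsub>?U\<^esub> H"
    then obtain a where a: "a \<in> carrier ?U" "C = H #>\<^bsub>?U\<^esub> a" unfolding RCOSETS_def by blast
    then have "0 < a" "coprime a (int n)" unfolding carrier_unit_group[OF n] by blast+
    then obtain t where t: "a = int t" using zero_less_imp_eq_int by blast
    have "coprime t n" using \<open>coprime a (int n)\<close> unfolding t coprime_int_iff .
    then show "C \<in> unit_orbit n H"
      unfolding unit_orbit_def a(2) coset t by blast
  qed
  then show ?thesis
    using U.lagrange[OF H] card_unit_group[OF n] by (simp add: Coset.order_def)
qed

section \<open>Cayley graphs of subgroups of the unit group\<close>

lemma has_valency_Cay:
  assumes n: "n > 0" and S: "S \<subseteq> {0..<int n}"
  shows "has_valency (Cay (integer_mod_group n) S) (card S)"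
  unfolding has_valency_def
proof
  fix v assume "v \<in> pverts (Cay (integer_mod_group n) S)"
  then have v: "v \<in> {0..<int n}" using n by (simp add: Cay_def carrier_integer_mod_group)
  have "out_arcs (with_proj (Cay (integer_mod_group n) S)) v =
      {(v, h) |h. h \<in> {0..<int n} \<and> (h - v) mod int n \<in> S}"
    using n v by (auto simp: out_arcs_def Cay_def carrier_integer_mod_group mod_simps)
  also have "bij_betw (\<lambda>s. (v, (v + s) mod int n)) S \<dots>"
  proof (rule bij_betw_byWitness[where f' = "\<lambda>(v, h). (h - v) mod int n"])
    show "\<forall>s\<in>S. (case (v, (v + s) mod int n) of (v, h) \<Rightarrow> (h - v) mod int n) = s"
      using S by (auto simp: mod_simps subset_iff)
    show "\<forall>a\<in>{(v, h) |h. h \<in> {0..<int n} \<and> (h - v) mod int n \<in> S}.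
        (v, (v + (case a of (v, h) \<Rightarrow> (h - v) mod int n)) mod int n) = a"
      by (auto simp: mod_simps)
    show "(\<lambda>s. (v, (v + s) mod int n)) ` S \<subseteq> {(v, h) |h. h \<in> {0..<int n} \<and> (h - v) mod int n \<in> S}"
      using S n by (auto simp: mod_simps subset_iff)
    show "(\<lambda>(v, h). (h - v) mod int n) ` {(v, h) |h. h \<in> {0..<int n} \<and> (h - v) mod int n \<in> S} \<subseteq> S"
      by auto
  qed
  ultimately show "out_degree (with_proj (Cay (integer_mod_group n) S)) v = card S"
    by (simp add: out_degree_def bij_betw_same_card)
qed

text \<open>Every vertex \<open>a\<close> is joined to \<open>a + 1\<close>, and steps of 1 reach
  all residues.\<close>

lemma connected_Cay:
  assumes n: "n > 1" and "1 \<in> S"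
  shows "Digraph_Component.connected (with_proj (Cay (integer_mod_group n) S))"
proof -
  let ?\<Gamma> = "with_proj (Cay (integer_mod_group n) S)"
  have verts: "verts (mk_symmetric ?\<Gamma>) = {0..<int n}"
    using n by (simp add: Cay_def carrier_integer_mod_group)
  have arc: "(a, (a + 1) mod int n) \<in> arcs_ends (mk_symmetric ?\<Gamma>)" if "a \<in> {0..<int n}" for a
  proof -
    have "(a, (a + 1) mod int n) \<in> parcs (Cay (integer_mod_group n) S)"
      using that assms by (simp add: Cay_def carrier_integer_mod_group mod_simps)
    then show ?thesis by (force simp: parcs_mk_symmetric mk_symmetric_def)
  qed
  have reach: "(u, (u + int k) mod int n) \<in> rtrancl_on {0..<int n} (arcs_ends (mk_symmetric ?\<Gamma>))"
    if u: "u \<in> {0..<int n}" for u k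
  proof (induction k)
    case 0
    then show ?case using u by simp
  next
    case (Suc k)
    have "((u + int k) mod int n, (u + int (Suc k)) mod int n) \<in> arcs_ends (mk_symmetric ?\<Gamma>)"
      using arc[of "(u + int k) mod int n"] n by (simp add: mod_simps add_ac)
    with Suc show ?case using n by (auto intro: rtrancl_on_into_rtrancl_on)
  qed
  have "(u, v) \<in> rtrancl_on {0..<int n} (arcs_ends (mk_symmetric ?\<Gamma>))"
    if "u \<in> {0..<int n}" "v \<in> {0..<int n}" for u v
    using reach[OF that(1), of "nat ((v - u) mod int n)"] that n by (simp add: mod_simps)
  then show ?thesis
    using n unfolding Digraph_Component.connected_def strongly_connected_def reachable_def verts by auto
qed

text \<open>The multiplicative subgroup \<open>H\<close> serves as a connection set in the additive
  group: containing \<open>- 1\<close> makes it symmetric, containing 1 makes the graph connected,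
  and its index \<open>p\<close> is the degree of the splitting field.\<close>

lemma subgroup_Cay:
  assumes n: "n > 1" and H: "subgroup H (units_of (residue_ring (int n)))"
    and minus_one: "- 1 mod int n \<in> H" and p: "p * card H = totient n"
  defines "\<Gamma> \<equiv> Cay (integer_mod_group n) H"
  shows "undirected_cayley (integer_mod_group n) \<Gamma>" "k_integral p \<Gamma>"
    "has_valency \<Gamma> (totient n div p)" "Digraph_Component.connected (with_proj \<Gamma>)"
proof -
  let ?U = "units_of (residue_ring (int n))"
  interpret H: subgroup H ?U by (rule H)
  have H_sub: "H \<subseteq> {x. 0 < x \<and> x < int n \<and> coprime x (int n)}"
    using H.subset carrier_unit_group[OF n] by simp
  then have H_sub': "H \<subseteq> {0..<int n}" by auto
  have one: "1 \<in> H" using H.one_closed one_unit_group[OF n] by simp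
  have tot: "totient n > 0" using n by simp
  then have pos: "p > 0" "card H > 0" using p by (auto intro!: gr0I)
  have inv_closed: "- h mod int n \<in> H" if "h \<in> H" for h
    using H.m_closed[OF minus_one that] by (simp add: mult_unit_group[OF n] mod_simps)
  have carr: "carrier (integer_mod_group n) = {0..<int n}"
    using n by (simp add: carrier_integer_mod_group)
  have "set_inv\<^bsub>integer_mod_group n\<^esub> H = (\<lambda>h. - h mod int n) ` H"
    unfolding SET_INV_def using H_sub' carr by (auto simp: subset_iff)
  also have "\<dots> = H"
  proof
    show "(\<lambda>h. - h mod int n) ` H \<subseteq> H" using inv_closed by blast
    show "H \<subseteq> (\<lambda>h. - h mod int n) ` H"
    proof
      fix h assume h: "h \<in> H"
      then have "h = - (- h mod int n) mod int n" using H_sub' by (auto simp: mod_simps subset_iff)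
      then show "h \<in> (\<lambda>h. - h mod int n) ` H" using inv_closed[OF h] by blast
    qed
  qed
  finally show "undirected_cayley (integer_mod_group n) \<Gamma>"
    unfolding undirected_cayley_def \<Gamma>_def using H_sub H_sub' one carr by auto
  have "card (unit_orbit n H) = p"
    using card_unit_orbit_subgroup[OF n H] p pos by (metis mult_cancel2 less_irrefl)
  then show "k_integral p \<Gamma>"
    using k_integral_Cay_integer_mod_group[of n H] n H_sub' by (simp add: \<Gamma>_def)
  have "card H = totient n div p" using p pos by (metis nonzero_mult_div_cancel_left less_irrefl)
  then show "has_valency \<Gamma> (totient n div p)"
    using has_valency_Cay[of n H] n H_sub' by (simp add: \<Gamma>_def)
  show "Digraph_Component.connected (with_proj \<Gamma>)"
    unfolding \<Gamma>_def by (rule connected_Cay[OF n one])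
qed

lemma minus_one_unit:
  assumes "n > 1"
  shows "- 1 mod int n \<in> carrier (units_of (residue_ring (int n)))"
proof -
  have "- 1 mod int n = int n - 1" using assms by (simp add: zmod_minus1)
  moreover have "coprime (int n - 1) (int n)" by (rule coprime_diff_one_left)
  ultimately show ?thesis using assms by (simp add: carrier_unit_group)
qed

text \<open>The \<open>p\<close>-th powers form a proper subgroup since \<open>p\<close> divides the
  group order, and it contains \<open>- 1\<close> because \<open>(- 1) ^ p = - 1\<close> for odd
  \<open>p\<close>. It is enlarged to one of index \<open>p\<close>.\<close>

lemma unit_subgroup_odd_index:
  assumes n: "n > 1" and p: "prime p" "odd p" "p dvd totient n"
  obtains H where "subgroup H (units_of (residue_ring (int n)))" "- 1 mod int n \<in> H"
    "p * card H = totient n"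
proof -
  let ?U = "units_of (residue_ring (int n))"
  interpret U: comm_group ?U by (rule comm_group_unit_group[OF n])
  let ?K = "(\<lambda>x. x [^]\<^bsub>?U\<^esub> p) ` carrier ?U"
  have fin: "finite (carrier ?U)"
    by (rule finite_subset[of _ "{0..<int n}"]) (auto simp: carrier_unit_group[OF n])
  have "p dvd card (carrier ?U)" using p(3) card_unit_group[OF n] by simp
  note K = U.power_image_proper[OF fin p(1) this]
  have pow: "\<exists>k. x [^]\<^bsub>?U\<^esub> (p ^ k) \<in> ?K" if "x \<in> carrier ?U" for x
    using that by (intro exI[of _ 1]) auto
  obtain H where H: "subgroup H ?U" "?K \<subseteq> H" "p * card H = card (carrier ?U)"
    by (rule U.exists_subgroup_prime_index[OF fin K p(1) pow])
  have "(- 1 mod int n) [^]\<^bsub>?U\<^esub> p = - 1 mod int n"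
    using pow_unit_group[OF n minus_one_unit[OF n], of p] p(2) by (simp add: power_mod)
  then have "- 1 mod int n \<in> ?K" using minus_one_unit[OF n] by (metis image_eqI)
  then show ?thesis using that H card_unit_group[OF n] by auto
qed

text \<open>The witness is 2 for odd \<open>n\<close>, \<open>n / 2 + 2\<close> for \<open>n\<close>
  twice an odd number and \<open>n / 2 + 1\<close> for \<open>n\<close> divisible by 4. The
  hypotheses leave out the moduli with totient at most 2.\<close>

lemma exists_nontrivial_unit:
  assumes "n \<ge> 5" "n \<noteq> 6"
  obtains x where "x \<in> carrier (units_of (residue_ring (int n)))" "x \<noteq> 1" "x \<noteq> int n - 1"
proof -
  have n: "n > 1" using assms by simp
  consider "odd n" | m where "n = 2 * m" "odd m" | m where "n = 2 * m" "even m"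
    by (cases "even n") (blast elim!: dvdE)+
  then show ?thesis
  proof cases
    case 1
    then have "coprime 2 (int n)" by simp
    then show ?thesis using assms that[of 2] by (simp add: carrier_unit_group)
  next
    case 2
    have "odd (int m)" using 2 by simp
    then have "coprime (int m + 2) 2" by simp
    moreover have "coprime (int m + 2) (int m)"
    proof -
      have "coprime 2 (int m)" using \<open>odd (int m)\<close> by simp
      then have "gcd 2 (int m) = 1" by (rule coprime_imp_gcd_eq_1)
      then show ?thesis
        using gcd_add1[of 2 "int m"] by (simp only: coprime_iff_gcd_eq_1 add.commute)
    qed
    ultimately have "coprime (int m + 2) (int n)" using 2 by simp
    moreover have "m \<ge> 5" using 2 assms by presburger
    ultimately have "int m + 2 \<in> carrier (units_of (residue_ring (int n)))"
      unfolding carrier_unit_group[OF n] using 2(1) by simp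
    then show ?thesis using \<open>m \<ge> 5\<close> 2(1) that[of "int m + 2"] by simp
  next
    case 3
    have "even (int m)" using 3 by simp
    then have "coprime (int m + 1) 2" by simp
    moreover have "coprime (int m + 1) (int m)" by simp
    ultimately have "coprime (int m + 1) (int n)" using 3 by simp
    then have "int m + 1 \<in> carrier (units_of (residue_ring (int n)))"
      unfolding carrier_unit_group[OF n] using 3(1) assms by simp
    then show ?thesis using 3 assms that[of "int m + 1"] by simp
  qed
qed

text \<open>Squares need not include \<open>- 1\<close>, so the subgroup to enlarge is
  \<open>{1, - 1}\<close>, proper by the nontrivial unit. The group order is a power of 2, so every
  element has a suitable power equal to 1.\<close>

lemma unit_subgroup_index_2:
  assumes n: "n \<ge> 5" "n \<noteq> 6" and m: "totient n = 2 ^ m"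
  obtains H where "subgroup H (units_of (residue_ring (int n)))" "- 1 mod int n \<in> H"
    "2 * card H = totient n"
proof -
  let ?U = "units_of (residue_ring (int n))"
  have n1: "n > 1" using n by simp
  interpret U: comm_group ?U by (rule comm_group_unit_group[OF n1])
  let ?K = "{1, int n - 1}"
  have fin: "finite (carrier ?U)"
    by (rule finite_subset[of _ "{0..<int n}"]) (auto simp: carrier_unit_group[OF n1])
  have eq: "- 1 mod int n = int n - 1" using n by (simp add: zmod_minus1)
  have mem: "1 \<in> carrier ?U" "int n - 1 \<in> carrier ?U"
    using U.one_closed one_unit_group[OF n1] minus_one_unit[OF n1] eq by auto
  have sq: "(int n - 1) * (int n - 1) mod int n = 1"
  proof -
    have "(int n - 1) * (int n - 1) = int n * (int n - 2) + 1" by (simp add: algebra_simps)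
    also have "\<dots> mod int n = 1" using n by (simp add: mod_simps)
    finally show ?thesis .
  qed
  have inv: "inv\<^bsub>?U\<^esub> (int n - 1) = int n - 1"
    using mem sq by (intro U.inv_equality) (auto simp: mult_unit_group[OF n1] one_unit_group[OF n1])
  have inv1: "inv\<^bsub>?U\<^esub> 1 = 1" using U.inv_one one_unit_group[OF n1] by simp
  have K: "subgroup ?K ?U"
    using mem n sq eq by (intro U.subgroupI) (auto simp: inv inv1 mult_unit_group[OF n1])
  have K': "?K \<noteq> carrier ?U" using exists_nontrivial_unit[OF n] by (metis insert_iff singletonD)
  have pow: "\<exists>k. x [^]\<^bsub>?U\<^esub> ((2::nat) ^ k) \<in> ?K" if "x \<in> carrier ?U" for x
  proof -
    have "x [^]\<^bsub>?U\<^esub> Coset.order ?U = 1"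
      using U.pow_order_eq_1[OF that] one_unit_group[OF n1] by simp
    then show ?thesis using m card_unit_group[OF n1] by (intro exI[of _ m]) (simp add: Coset.order_def)
  qed
  obtain H where H: "subgroup H ?U" "?K \<subseteq> H" "2 * card H = card (carrier ?U)"
    by (rule U.exists_subgroup_prime_index[OF fin K K' two_is_prime_nat pow])
  then show ?thesis using that eq card_unit_group[OF n1] by auto
qed

lemma cyclic_integer_mod_group:
  assumes "n > 1"
  shows "cyclic_group (integer_mod_group n)"
proof -
  have "x \<in> range (\<lambda>k::int. 1 [^]\<^bsub>integer_mod_group n\<^esub> k)" if "x \<in> {0..<int n}" for x
    using that by (intro image_eqI[of _ _ x]) (auto simp: int_pow_integer_mod_group)
  then show ?thesis
    using assms unfolding group.cyclic_group[OF group_integer_mod_group]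
    by (intro bexI[of _ 1]) (auto simp: carrier_integer_mod_group int_pow_integer_mod_group)
qed

theorem corollary4p6:
  shows "(\<forall>n::nat. n \<ge> 5 \<and> n \<noteq> 6 \<longrightarrow>
            ((\<nexists>m::nat. totient n = 2 ^ m) \<longrightarrow>
               (\<forall>p::nat. prime p \<and> odd p \<and> p dvd totient n \<longrightarrow>
                  (\<exists>\<Gamma>. undirected_cayley (integer_mod_group n) \<Gamma> \<and> k_integral p \<Gamma> \<and>
                        has_valency \<Gamma> (totient n div p)))) \<and>
            ((\<exists>m::nat. totient n = 2 ^ m) \<longrightarrow>
               (\<exists>\<Gamma>. undirected_cayley (integer_mod_group n) \<Gamma> \<and> k_integral 2 \<Gamma> \<and>
                     has_valency \<Gamma> (totient n div 2)))) \<and>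
         (\<forall>p k::nat. prime p \<and> k \<ge> 3 \<longrightarrow>
            (\<exists>\<Gamma> :: int pair_pre_digraph.
               undirected_circulant \<Gamma> \<and> Digraph_Component.connected (with_proj \<Gamma>) \<and>
               k_integral p \<Gamma> \<and> card (pverts \<Gamma>) = p ^ k \<and>
               has_valency \<Gamma> (p ^ (k - 2) * (p - 1))))"
proof (rule conjI; intro allI impI)
  fix n :: nat assume n: "n \<ge> 5 \<and> n \<noteq> 6"
  then have n1: "n > 1" by simp
  show "((\<nexists>m::nat. totient n = 2 ^ m) \<longrightarrow>
               (\<forall>p::nat. prime p \<and> odd p \<and> p dvd totient n \<longrightarrow>
                  (\<exists>\<Gamma>. undirected_cayley (integer_mod_group n) \<Gamma> \<and> k_integral p \<Gamma> \<and>
                        has_valency \<Gamma> (totient n div p)))) \<and>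
            ((\<exists>m::nat. totient n = 2 ^ m) \<longrightarrow>
               (\<exists>\<Gamma>. undirected_cayley (integer_mod_group n) \<Gamma> \<and> k_integral 2 \<Gamma> \<and>
                     has_valency \<Gamma> (totient n div 2)))"
  proof (intro conjI impI allI)
    fix p :: nat assume "prime p \<and> odd p \<and> p dvd totient n"
    then obtain H where "subgroup H (units_of (residue_ring (int n)))" "- 1 mod int n \<in> H"
      "p * card H = totient n" using unit_subgroup_odd_index[OF n1] by blast
    from subgroup_Cay[OF n1 this]
    show "\<exists>\<Gamma>. undirected_cayley (integer_mod_group n) \<Gamma> \<and> k_integral p \<Gamma> \<and>
      has_valency \<Gamma> (totient n div p)" by blast
  next
    assume "\<exists>m::nat. totient n = 2 ^ m"
    then obtain H where "subgroup H (units_of (residue_ring (int n)))" "- 1 mod int n \<in> H"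
      "2 * card H = totient n" using unit_subgroup_index_2 n by blast
    from subgroup_Cay[OF n1 this]
    show "\<exists>\<Gamma>. undirected_cayley (integer_mod_group n) \<Gamma> \<and> k_integral 2 \<Gamma> \<and>
      has_valency \<Gamma> (totient n div 2)" by blast
  qed
next
  fix p k :: nat assume pk: "prime p \<and> k \<ge> 3"
  define n where "n = p ^ k"
  have p2: "p \<ge> 2" using pk prime_ge_2_nat by blast
  \<comment> \<open>The order is at least 8, so the conditions \<open>n \<ge> 5\<close> and
    \<open>n \<noteq> 6\<close> hold even for \<open>p = 2\<close>.\<close>
  have "(2::nat) ^ 3 \<le> p ^ 3" using p2 by (intro power_mono) auto
  also have "\<dots> \<le> n" unfolding n_def using pk p2 by (intro power_increasing) auto
  finally have n8: "n \<ge> 8" by simp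
  then have n1: "n > 1" by simp
  have tot: "totient n = p ^ (k - 1) * (p - 1)"
    unfolding n_def using pk by (intro totient_prime_power) auto
  \<comment> \<open>One factor \<open>p\<close> of the totient becomes the index of
    \<open>H\<close>; the remaining factor is the valency.\<close>
  have "p ^ (k - 1) = p * p ^ (k - 2)"
  proof -
    have "k - 1 = Suc (k - 2)" using pk by linarith
    then show ?thesis by simp
  qed
  then have tot': "totient n = p * (p ^ (k - 2) * (p - 1))" using tot by simp
  obtain H where H: "subgroup H (units_of (residue_ring (int n)))" "- 1 mod int n \<in> H"
    "p * card H = totient n"
  proof (cases "p = 2")
    case True
    have "totient n = 2 ^ (k - 1)" using tot True by simp
    then show ?thesis using unit_subgroup_index_2[of n "k - 1"] n8 that True by auto
  next
    case False
    then have "odd p" using pk primes_dvd_imp_eq two_is_prime_nat by blast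
    then show ?thesis using unit_subgroup_odd_index[OF n1, of p] pk tot' that by auto
  qed
  note \<Gamma> = subgroup_Cay[OF n1 H]
  have "totient n div p = p ^ (k - 2) * (p - 1)" using tot' p2 by simp
  moreover have "card (pverts (Cay (integer_mod_group n) H)) = n"
    using n1 by (simp add: Cay_def carrier_integer_mod_group)
  moreover have "undirected_circulant (Cay (integer_mod_group n) H)"
    unfolding undirected_circulant_def using cyclic_integer_mod_group[OF n1] \<Gamma>(1) by blast
  ultimately show "\<exists>\<Gamma> :: int pair_pre_digraph.
               undirected_circulant \<Gamma> \<and> Digraph_Component.connected (with_proj \<Gamma>) \<and>
               k_integral p \<Gamma> \<and> card (pverts \<Gamma>) = p ^ k \<and>
               has_valency \<Gamma> (p ^ (k - 2) * (p - 1))"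
    using \<Gamma>(2-4) by (auto simp: n_def)
qed

end
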